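(* Let $G$ be a graph with $n\ge 5432$ vertices such that $\lambda(G)\ge \lambda(T_{n,2})$. Then $G$ has at least $2\lfloor \frac{n}{2}\rfloor -1$ triangular edges, unless $G=T_{n,2}$.
   Context: All graphs are finite and simple. $\lambda(G)$ denotes the spectral radius of $G$, i.e. the largest eigenvalue of its adjacency matrix. $T_{n,2}$ denotes the bipartite Turán graph, i.e. the complete bipartite graph on $n$ vertices with parts of sizes $\lceil n/2\rceil$ and $\lfloor n/2\rfloor$. An edge of $G$ is called triangular if it is contained in a triangle of $G$. Equality of graphs means isomorphism. *)

theory Defs
  imports "Graph_Theory.Graph_Theory" "Jordan_Normal_Form.Spectral_Radius"
begin

text \<open>
  A finite simple graph is a \<open>pair_graph\<close>: a finite loop-free symmetric pair digraph,
  in which the undirected edge \<open>{u, v}\<close> is represented by the two arcs \<open>(u, v)\<close> and \<open>(v, u)\<close>.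
\<close>

definition adjacency_matrix :: "'a list \<Rightarrow> 'a pair_pre_digraph \<Rightarrow> real mat" where
  "adjacency_matrix vs G =
     mat (length vs) (length vs) (\<lambda>(i, j). if (vs ! i, vs ! j) \<in> parcs G then 1 else 0)"

text \<open>The choice of the enumeration of the vertices does not matter: see
  \<open>graph_spectral_radius_eq\<close>. Since the adjacency matrix is real symmetric, its real spectrum is
  its whole spectrum, and is nonempty whenever the graph has a vertex.\<close>

definition graph_spectral_radius :: "'a pair_pre_digraph \<Rightarrow> real" where
  "graph_spectral_radius G =
     Max (spectrum (adjacency_matrix (SOME vs. distinct vs \<and> set vs = pverts G) G))"

definition turan_graph_2 :: "nat \<Rightarrow> nat pair_pre_digraph" where
  "turan_graph_2 n =
     (let A = {..<nat \<lceil>real n / 2\<rceil>}; B = {nat \<lceil>real n / 2\<rceil>..<n}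
      in \<lparr>pverts = A \<union> B, parcs = A \<times> B \<union> B \<times> A\<rparr>)"

text \<open>Edges are counted as unordered pairs; in a loop-free graph the three vertices
  of a triangle are automatically distinct.\<close>

definition triangular_edges :: "'a pair_pre_digraph \<Rightarrow> 'a set set" where
  "triangular_edges G =
     {{u, v} | u v. (u, v) \<in> parcs G \<and> (\<exists>w. (u, w) \<in> parcs G \<and> (v, w) \<in> parcs G)}"

abbreviation graph_iso :: "'a pair_pre_digraph \<Rightarrow> 'b pair_pre_digraph \<Rightarrow> bool" where
  "graph_iso G H \<equiv> digraph_iso (with_proj G) (with_proj H)"

lemma complete_bipartite_turan_graph_2:
  "complete_bipartite_digraph (nat \<lceil>real n / 2\<rceil>) (nat \<lfloor>real n / 2\<rfloor>) (with_proj (turan_graph_2 n))"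
proof -
  have *: "nat \<lceil>real n / 2\<rceil> \<le> n" "n - nat \<lceil>real n / 2\<rceil> = nat \<lfloor>real n / 2\<rfloor>"
    by linarith+
  let ?c = "nat \<lceil>real n / 2\<rceil>"
  show ?thesis
    unfolding complete_bipartite_digraph_pair_def turan_graph_2_def Let_def
    by (rule conjI, simp, rule exI[of _ "{..<?c}"], rule exI[of _ "{?c..<n}"]) (use * in \<open>auto simp del: nat_ceiling_le_eq simp: not_less\<close>)
qed

lemma eigenvalue_adjacency_matrix_iff:
  assumes "distinct vs"
  shows "eigenvalue (adjacency_matrix vs G) k \<longleftrightarrow>
    (\<exists>f. (\<exists>u\<in>set vs. f u \<noteq> 0) \<and>
      (\<forall>u\<in>set vs. (\<Sum>v\<in>set vs. if (u, v) \<in> parcs G then f v else 0) = k * f u))"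
    (is "_ \<longleftrightarrow> (\<exists>f. ?P f)")
proof -
  let ?n = "length vs"
  have bij: "bij_betw ((!) vs) {0..<?n} (set vs)"
    using assms by (intro bij_betw_nth) auto
  have dims: "dim_row (adjacency_matrix vs G) = ?n" "dim_col (adjacency_matrix vs G) = ?n"
    by (simp_all add: adjacency_matrix_def)
  have P: "eigenvector (adjacency_matrix vs G) (vec ?n (\<lambda>i. f (vs ! i))) k \<longleftrightarrow> ?P f" for f
  proof -
    have row: "row (adjacency_matrix vs G) i \<bullet> vec ?n (\<lambda>i. f (vs ! i))
        = (\<Sum>v\<in>set vs. if (vs ! i, v) \<in> parcs G then f v else 0)" if "i < ?n" for i
    proof -
      have "row (adjacency_matrix vs G) i \<bullet> vec ?n (\<lambda>i. f (vs ! i))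
          = (\<Sum>j\<in>{0..<?n}. if (vs ! i, vs ! j) \<in> parcs G then f (vs ! j) else 0)"
        unfolding scalar_prod_def using that
        by (auto simp: adjacency_matrix_def intro!: sum.cong)
      also have "\<dots> = (\<Sum>v\<in>set vs. if (vs ! i, v) \<in> parcs G then f v else 0)"
        by (rule sum.reindex_bij_betw[OF bij])
      finally show ?thesis .
    qed
    have "vec ?n (\<lambda>i. f (vs ! i)) \<noteq> 0\<^sub>v ?n \<longleftrightarrow> (\<exists>u\<in>set vs. f u \<noteq> 0)"
      unfolding set_conv_nth by (auto simp: vec_eq_iff)
    moreover have "adjacency_matrix vs G *\<^sub>v vec ?n (\<lambda>i. f (vs ! i)) = k \<cdot>\<^sub>v vec ?n (\<lambda>i. f (vs ! i))
        \<longleftrightarrow> (\<forall>i<?n. row (adjacency_matrix vs G) i \<bullet> vec ?n (\<lambda>i. f (vs ! i)) = k * f (vs ! i))"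
      by (simp add: vec_eq_iff dims)
    ultimately show ?thesis
      by (simp add: eigenvector_def dims all_set_conv_all_nth row)
  qed
  show ?thesis
  proof
    assume "eigenvalue (adjacency_matrix vs G) k"
    then obtain x where x: "eigenvector (adjacency_matrix vs G) x k"
      by (auto simp: eigenvalue_def)
    then have "dim_vec x = ?n" by (auto simp: eigenvector_def adjacency_matrix_def)
    define f where "f v = x $ (the_inv_into {0..<?n} ((!) vs) v)" for v
    have "x = vec ?n (\<lambda>i. f (vs ! i))"
      using \<open>dim_vec x = ?n\<close> bij
      by (auto simp: vec_eq_iff f_def bij_betw_def the_inv_into_f_f)
    with x have "eigenvector (adjacency_matrix vs G) (vec ?n (\<lambda>i. f (vs ! i))) k" by simp
    then have "?P f" unfolding P .
    then show "\<exists>f. ?P f" by (intro exI[of _ f])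
  next
    assume "\<exists>f. ?P f"
    then obtain f where "?P f" by (rule exE)
    then have "eigenvector (adjacency_matrix vs G) (vec ?n (\<lambda>i. f (vs ! i))) k"
      unfolding P .
    then show "eigenvalue (adjacency_matrix vs G) k"
      unfolding eigenvalue_def by (rule exI)
  qed
qed

lemma graph_spectral_radius_eq:
  assumes "distinct vs" "set vs = pverts G"
  shows "graph_spectral_radius G = Max (spectrum (adjacency_matrix vs G))"
proof -
  define ws where "ws = (SOME vs. distinct vs \<and> set vs = pverts G)"
  have "distinct ws \<and> set ws = pverts G"
    unfolding ws_def by (rule someI[of _ vs]) (use assms in simp)
  then have ws: "distinct ws" "set ws = pverts G" by auto
  have "eigenvalue (adjacency_matrix ws G) k = eigenvalue (adjacency_matrix vs G) k" for k
    unfolding eigenvalue_adjacency_matrix_iff[OF assms(1)]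
      eigenvalue_adjacency_matrix_iff[OF ws(1)] ws(2) assms(2) by (rule refl)
  then have "spectrum (adjacency_matrix ws G) = spectrum (adjacency_matrix vs G)"
    unfolding spectrum_def by (rule Collect_cong)
  then show ?thesis by (simp add: graph_spectral_radius_def ws_def)
qed

end

theory Submission
  imports Defs "HOL-Analysis.Analysis"
begin

text \<open>Suppose \<open>G\<close> has at most \<open>2 f - 2\<close> triangular edges, where \<open>f = n div 2\<close>. Then \<open>G\<close> has few
  triangles, and testing the positive semidefinite form of \<open>A + lam I\<close> on neighbourhoods gives
  \<open>2 lam\<^sup>3 \<le> triangles + lam * arcs\<close>, so \<open>G\<close> has almost \<open>n\<^sup>2 / 4\<close> edges. Counting triangles again
  forces a large minimum degree, and a maximum independent set then yields a bipartition in which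
  every edge inside a part lies in more than \<open>n / 3\<close> triangles; as there are fewer than \<open>2 n\<close>
  triangular arcs, at most one such edge exists. If there is none, the edge count forces
  \<open>G\<close> to be the Turan graph. If there is one, its ends have at most \<open>f - 2\<close> common neighbours, and
  summing the Perron eigenvector over the parts of this nearly bipartite graph gives
  \<open>lam\<^sup>2 < f (n - f)\<close>.\<close>

section \<open>Adjacency form and Perron vector\<close>

text \<open>In spectral terms \<open>arcs\<close> and \<open>triangles\<close> are the traces of the
  square and the cube of the adjacency matrix. The inequality with \<open>2 * lam ^ 3\<close> keeps
  the top term of the sum of \<open>mu^2 * (mu + lam)\<close> over all eigenvalues
  \<open>mu\<close>; the other terms are nonnegative because \<open>mu >= - lam\<close>. The size of
  \<open>n\<close> enters through the triangles: fewer than \<open>2 * n\<close> triangular arcs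
  allow at most \<open>2 * n * sqrt (2 * n)\<close> ordered triangles, and this is at most
  \<open>n^2 / 26\<close> from \<open>n = 5408\<close> on. The later decimals are roundings that
  still fit at \<open>n = 5432\<close>. Counting cannot exclude the last inner edge. For
  \<open>n = 2 * f\<close>, take the Turan graph with one inner edge added and two cross edges
  removed so that the ends of the inner edge keep \<open>f - 2\<close> common neighbours. It has
  only two arcs fewer than the Turan graph, while its \<open>6 * (f - 2)\<close> ordered triangles
  weaken the resulting bound on \<open>2 * lam^2\<close> by almost six. Hence the separate
  eigenvector argument.\<close>

locale simple_graph =
  fixes V :: "'a set" and adj :: "'a \<Rightarrow> 'a \<Rightarrow> bool"
  assumes finite_V: "finite V"
    and adj_sym: "adj u v \<Longrightarrow> adj v u"
    and adj_irrefl: "\<not> adj u u"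
    and adj_V: "adj u v \<Longrightarrow> u \<in> V"
begin

abbreviation e :: "'a \<Rightarrow> 'a \<Rightarrow> real" where "e u v \<equiv> of_bool (adj u v)"

lemma e_commute: "e u v = e v u"
  using adj_sym by auto

definition adj_op :: "('a \<Rightarrow> real) \<Rightarrow> 'a \<Rightarrow> real" where
  "adj_op y u = (\<Sum>v\<in>V. e u v * y v)"

definition adj_form :: "('a \<Rightarrow> real) \<Rightarrow> real" where
  "adj_form y = (\<Sum>u\<in>V. y u * adj_op y u)"

lemma adj_op_symmetric: "(\<Sum>u\<in>V. z u * adj_op y u) = (\<Sum>u\<in>V. adj_op z u * y u)"
proof -
  have "(\<Sum>u\<in>V. z u * adj_op y u) = (\<Sum>u\<in>V. \<Sum>v\<in>V. z u * (e u v * y v))"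
    by (simp add: adj_op_def sum_distrib_left)
  also have "\<dots> = (\<Sum>v\<in>V. \<Sum>u\<in>V. z u * (e u v * y v))"
    by (rule sum.swap)
  also have "\<dots> = (\<Sum>v\<in>V. adj_op z v * y v)"
    unfolding adj_op_def sum_distrib_right
    by (intro sum.cong refl) (simp add: e_commute mult_ac)
  finally show ?thesis .
qed

lemma adj_op_add: "adj_op (\<lambda>u. y u + c * z u) u = adj_op y u + c * adj_op z u"
  by (simp add: adj_op_def sum.distrib sum_distrib_left algebra_simps)

lemma adj_form_add:
  "adj_form (\<lambda>u. y u + c * z u) = adj_form y + 2 * c * (\<Sum>u\<in>V. adj_op y u * z u) + c\<^sup>2 * adj_form z"
proof -
  have "adj_form (\<lambda>u. y u + c * z u)
      = adj_form y + c * (\<Sum>u\<in>V. y u * adj_op z u) + c * (\<Sum>u\<in>V. adj_op y u * z u) + c\<^sup>2 * adj_form z"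
    by (simp add: adj_form_def adj_op_add sum.distrib sum_distrib_left power2_eq_square algebra_simps)
  then show ?thesis by (simp add: adj_op_symmetric)
qed

lemma adj_form_scale: "adj_form (\<lambda>u. c * z u) = c\<^sup>2 * adj_form z"
  by (simp add: adj_form_def adj_op_def sum_distrib_left power2_eq_square algebra_simps)

lemma adj_form_le_abs: "\<bar>adj_form y\<bar> \<le> adj_form (\<lambda>u. \<bar>y u\<bar>)"
proof -
  have "\<bar>adj_form y\<bar> \<le> (\<Sum>u\<in>V. \<bar>y u * adj_op y u\<bar>)"
    unfolding adj_form_def by (rule sum_abs)
  also have "\<dots> \<le> adj_form (\<lambda>u. \<bar>y u\<bar>)"
    unfolding adj_form_def
  proof (rule sum_mono)
    fix u
    have "\<bar>adj_op y u\<bar> \<le> (\<Sum>v\<in>V. \<bar>e u v * y v\<bar>)"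
      unfolding adj_op_def by (rule sum_abs)
    also have "\<dots> = adj_op (\<lambda>u. \<bar>y u\<bar>) u"
      by (simp add: adj_op_def abs_mult)
    finally show "\<bar>y u * adj_op y u\<bar> \<le> \<bar>y u\<bar> * adj_op (\<lambda>u. \<bar>y u\<bar>) u"
      by (simp add: abs_mult mult_left_mono)
  qed
  finally show ?thesis .
qed

lemma ex_max_adj_form:
  assumes "V \<noteq> {}"
  obtains x where "(\<Sum>u\<in>V. (x u)\<^sup>2) = 1"
    "\<And>y. (\<Sum>u\<in>V. (y u)\<^sup>2) = 1 \<Longrightarrow> adj_form y \<le> adj_form x"
proof -
  \<comment> \<open>The type may be infinite, so coordinates outside \<open>V\<close> are pinned to
    0 and compactness comes from a product of compact sets. The box loses nothing: unit vectors have
    coordinates in \<open>[-1, 1]\<close>.\<close>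
  define K where "K = PiE UNIV (\<lambda>u. if u \<in> V then {-1..1::real} else {0})"
  define S where "S = K \<inter> {y. (\<Sum>u\<in>V. (y u)\<^sup>2) = 1}"
  have "compactin (product_topology (\<lambda>_. euclidean) UNIV) K"
    unfolding K_def compactin_PiE by auto
  then have "compact K" by (simp add: euclidean_product_topology)
  have coord: "continuous_on UNIV (\<lambda>y::'a \<Rightarrow> real. y u)" for u
    by (rule continuous_on_product_coordinates)
  have "continuous_on UNIV (\<lambda>y::'a \<Rightarrow> real. \<Sum>u\<in>V. (y u)\<^sup>2)"
    by (intro continuous_intros coord)
  then have "closed ((\<lambda>y::'a \<Rightarrow> real. \<Sum>u\<in>V. (y u)\<^sup>2) -` {1})"
    by (intro closed_vimage) auto
  then have "compact S"
    unfolding S_def using \<open>compact K\<close> by (intro compact_Int_closed) (auto simp: vimage_def)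
  obtain v where v: "v \<in> V" using assms by auto
  have "(\<Sum>u\<in>V. (of_bool (u = v))\<^sup>2) = (\<Sum>u\<in>V. of_bool (u = v) :: real)"
    by (intro sum.cong) auto
  then have "(\<lambda>u. of_bool (u = v)) \<in> S"
    using v finite_V by (auto simp: S_def K_def)
  then have "S \<noteq> {}" by auto
  have "continuous_on S adj_form"
    unfolding adj_form_def adj_op_def
    by (intro continuous_intros continuous_on_subset[OF coord]) auto
  from continuous_attains_sup[OF \<open>compact S\<close> \<open>S \<noteq> {}\<close> this]
  obtain x where x: "x \<in> S" "\<And>y. y \<in> S \<Longrightarrow> adj_form y \<le> adj_form x" by auto
  show ?thesis
  proof
    show "(\<Sum>u\<in>V. (x u)\<^sup>2) = 1" using x by (auto simp: S_def)
    fix y :: "'a \<Rightarrow> real" assume y: "(\<Sum>u\<in>V. (y u)\<^sup>2) = 1"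
    define z where "z u = (if u \<in> V then y u else 0)" for u
    have "\<bar>y u\<bar> \<le> 1" if "u \<in> V" for u
    proof -
      have "(y u)\<^sup>2 \<le> (\<Sum>u\<in>V. (y u)\<^sup>2)"
        using that finite_V by (intro member_le_sum) auto
      then show ?thesis using y by (simp add: abs_square_le_1)
    qed
    then have "z \<in> S" using y by (auto simp: S_def K_def z_def abs_le_iff minus_le_iff)
    moreover have "adj_form z = adj_form y"
      by (simp add: adj_form_def adj_op_def z_def)
    ultimately show "adj_form y \<le> adj_form x" using x(2) by fastforce
  qed
qed

end

text \<open>\<open>form_le\<close> makes \<open>lam\<close> the maximum of the Rayleigh quotient,
  which stands in for a diagonalisation of the adjacency matrix. The vector is only nonnegative,
  since the graph may be disconnected.\<close>

locale perron = simple_graph +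
  fixes lam :: real and x :: "'a \<Rightarrow> real"
  assumes x_nonneg: "x u \<ge> 0"
    and x_unit: "(\<Sum>u\<in>V. (x u)\<^sup>2) = 1"
    and x_eigen: "u \<in> V \<Longrightarrow> adj_op x u = lam * x u"
    and form_le: "adj_form y \<le> lam * (\<Sum>u\<in>V. (y u)\<^sup>2)"

text \<open>Taking absolute values of a maximiser cannot lower the form. The eigenvalue equation is
  the first-order condition at the maximum, found by varying one coordinate.\<close>

lemma (in simple_graph) ex_perron:
  assumes "V \<noteq> {}"
  obtains lam x where "perron V adj lam x"
proof -
  obtain x0 where x0: "(\<Sum>u\<in>V. (x0 u)\<^sup>2) = 1"
    "\<And>y. (\<Sum>u\<in>V. (y u)\<^sup>2) = 1 \<Longrightarrow> adj_form y \<le> adj_form x0"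
    using ex_max_adj_form[OF assms] by blast
  define x where "x u = \<bar>x0 u\<bar>" for u
  define lam where "lam = adj_form x"
  have unit: "(\<Sum>u\<in>V. (x u)\<^sup>2) = 1" using x0(1) by (simp add: x_def)
  have "adj_form x0 \<le> lam"
    using adj_form_le_abs[of x0] by (simp add: lam_def x_def[abs_def])
  then have le1: "adj_form y \<le> lam" if "(\<Sum>u\<in>V. (y u)\<^sup>2) = 1" for y
    using x0(2)[OF that] by simp
  have le: "adj_form y \<le> lam * (\<Sum>u\<in>V. (y u)\<^sup>2)" for y
  proof (cases "(\<Sum>u\<in>V. (y u)\<^sup>2) = 0")
    case True
    then have "\<forall>u\<in>V. y u = 0" using finite_V by (simp add: sum_nonneg_eq_0_iff)
    then show ?thesis using True by (simp add: adj_form_def)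
  next
    case False
    define s where "s = (\<Sum>u\<in>V. (y u)\<^sup>2)"
    have "s > 0" unfolding s_def using False sum_nonneg[of V "\<lambda>u. (y u)\<^sup>2"] by force
    have "(\<Sum>u\<in>V. (1 / sqrt s * y u)\<^sup>2) = (\<Sum>u\<in>V. (y u)\<^sup>2) / s"
      using \<open>s > 0\<close> by (simp add: power_mult_distrib power_divide sum_divide_distrib)
    also have "\<dots> = 1" using \<open>s > 0\<close> by (simp add: s_def)
    finally have "adj_form (\<lambda>u. 1 / sqrt s * y u) \<le> lam" by (rule le1)
    then have "adj_form y / s \<le> lam"
      unfolding adj_form_scale using \<open>s > 0\<close> by (simp add: power_divide)
    then show ?thesis using \<open>s > 0\<close> by (simp add: s_def pos_divide_le_eq)
  qed
  have eig: "adj_op x u = lam * x u" if u: "u \<in> V" for u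
  proof -
    define g where "g = adj_op x u - lam * x u"
    have quad: "2 * t * g \<le> lam * t\<^sup>2" for t :: real
    proof -
      let ?z = "\<lambda>v. of_bool (v = u) :: real"
      have "adj_form ?z = 0"
        using u finite_V adj_irrefl by (simp add: adj_form_def adj_op_def)
      moreover have "(\<Sum>v\<in>V. adj_op x v * ?z v) = adj_op x u"
        using u finite_V by simp
      ultimately have 1: "adj_form (\<lambda>v. x v + t * ?z v) = lam + 2 * t * adj_op x u"
        unfolding adj_form_add lam_def by simp
      have "(\<Sum>v\<in>V. (x v + t * ?z v)\<^sup>2) = (\<Sum>v\<in>V. (x v)\<^sup>2 + (2 * t * x v + t\<^sup>2) * ?z v)"
        by (intro sum.cong) (auto simp: power2_eq_square algebra_simps)
      also have "\<dots> = 1 + 2 * t * x u + t\<^sup>2"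
        using u finite_V unit by (simp add: sum.distrib)
      finally have "adj_form (\<lambda>v. x v + t * ?z v) \<le> lam * (1 + 2 * t * x u + t\<^sup>2)"
        using le by metis
      then show ?thesis unfolding 1 by (simp add: g_def algebra_simps)
    qed
    have "g = 0"
    proof (rule ccontr)
      assume "g \<noteq> 0"
      \<comment> \<open>With a positive \<open>L\<close> above \<open>lam\<close>, the step
        \<open>g / L\<close> makes the linear gain exceed the quadratic loss.\<close>
      define L where "L = \<bar>lam\<bar> + 1"
      have "2 * (g / L) * g \<le> lam * (g / L)\<^sup>2" by (rule quad)
      also have "\<dots> \<le> L * (g / L)\<^sup>2" by (intro mult_right_mono) (auto simp: L_def)
      also have "\<dots> = (g / L) * g" using L_def by (simp add: power2_eq_square)
      finally have "(g / L) * g \<le> 0" by simp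
      moreover have "(g / L) * g > 0"
        using \<open>g \<noteq> 0\<close> by (simp add: L_def flip: power2_eq_square)
      ultimately show False by simp
    qed
    then show ?thesis by (simp add: g_def)
  qed
  have "perron V adj lam x"
    by unfold_locales (use unit eig le in \<open>auto simp: x_def\<close>)
  then show ?thesis by (rule that)
qed

context perron
begin

lemma form_ge: "- lam * (\<Sum>u\<in>V. (y u)\<^sup>2) \<le> adj_form y"
  using adj_form_le_abs[of y] form_le[of "\<lambda>u. \<bar>y u\<bar>"] by (simp add: abs_le_iff)

lemma lam_nonneg: "lam \<ge> 0"
proof -
  have "adj_form x \<ge> 0"
    unfolding adj_form_def adj_op_def using x_nonneg by (intro sum_nonneg mult_nonneg_nonneg) auto
  then show ?thesis using form_le[of x] by (simp add: x_unit)
qed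

end

section \<open>Counting triangles\<close>

context simple_graph
begin

definition deg :: "'a \<Rightarrow> real" where
  "deg u = (\<Sum>v\<in>V. e u v)"

definition codeg :: "'a \<Rightarrow> 'a \<Rightarrow> real" where
  "codeg u v = (\<Sum>w\<in>V. e u w * e v w)"

definition arcs :: real where
  "arcs = (\<Sum>u\<in>V. deg u)"

text \<open>Ordered triangles: every triangle is counted six times.\<close>

definition triangles :: real where
  "triangles = (\<Sum>u\<in>V. \<Sum>v\<in>V. e u v * codeg u v)"

definition tri :: "'a \<Rightarrow> 'a \<Rightarrow> bool" where
  "tri u v \<longleftrightarrow> adj u v \<and> (\<exists>w. adj u w \<and> adj v w)"

abbreviation t :: "'a \<Rightarrow> 'a \<Rightarrow> real" where "t u v \<equiv> of_bool (tri u v)"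

definition tdeg :: "'a \<Rightarrow> real" where
  "tdeg u = (\<Sum>v\<in>V. t u v)"

definition tarcs :: real where
  "tarcs = (\<Sum>u\<in>V. tdeg u)"

lemma tri_sym: "tri u v \<Longrightarrow> tri v u"
  unfolding tri_def using adj_sym by blast

lemma tdeg_nonneg: "tdeg u \<ge> 0"
  by (simp add: tdeg_def sum_nonneg)

lemma tarcs_nonneg: "tarcs \<ge> 0"
  by (simp add: tarcs_def sum_nonneg tdeg_nonneg)

text \<open>For fixed \<open>u\<close> the inner sum counts the arcs inside the neighbourhood of
  \<open>u\<close>. They join triangular neighbours of \<open>u\<close>, hence the bound
  \<open>(tdeg u)^2\<close>, and are triangular themselves, hence the bound \<open>tarcs\<close>.
  The geometric mean of the two sums to a bound of Kruskal-Katona type.\<close>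

lemma triangles_le: "triangles \<le> tarcs * sqrt tarcs"
proof -
  have "(\<Sum>v\<in>V. e u v * codeg u v) \<le> tdeg u * sqrt tarcs" for u
  proof -
    let ?m = "\<Sum>v\<in>V. e u v * codeg u v"
    have m: "?m = (\<Sum>v\<in>V. \<Sum>w\<in>V. e u v * (e u w * e v w))"
      by (simp add: codeg_def sum_distrib_left)
    have *: "e u v * (e u w * e v w) \<le> t u v * t u w" "e u v * (e u w * e v w) \<le> t v w" for v w
    proof -
      have "tri u v \<and> tri u w \<and> tri v w" if "adj u v" "adj u w" "adj v w"
        unfolding tri_def using that adj_sym by blast
      then show "e u v * (e u w * e v w) \<le> t u v * t u w" "e u v * (e u w * e v w) \<le> t v w"
        by (cases "adj u v \<and> adj u w \<and> adj v w"; auto)+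
    qed
    have "?m \<le> (\<Sum>v\<in>V. \<Sum>w\<in>V. t u v * t u w)"
      unfolding m by (intro sum_mono *)
    also have "\<dots> = (tdeg u)\<^sup>2"
      by (simp add: tdeg_def power2_eq_square sum_product)
    finally have 1: "?m \<le> (tdeg u)\<^sup>2" .
    have 2: "?m \<le> tarcs"
      unfolding m tarcs_def tdeg_def by (intro sum_mono *)
    have 0: "0 \<le> ?m" unfolding m by (intro sum_nonneg) auto
    have "?m\<^sup>2 \<le> (tdeg u)\<^sup>2 * tarcs"
      unfolding power2_eq_square[of ?m] using 0 1 2 by (intro mult_mono) auto
    also have "\<dots> = (tdeg u * sqrt tarcs)\<^sup>2"
      by (simp add: power_mult_distrib tarcs_nonneg)
    finally show ?thesis
      by (rule power2_le_imp_le) (simp add: tdeg_nonneg tarcs_nonneg)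
  qed
  then have "triangles \<le> (\<Sum>u\<in>V. tdeg u * sqrt tarcs)"
    unfolding triangles_def by (intro sum_mono)
  also have "\<dots> = tarcs * sqrt tarcs"
    by (simp add: tarcs_def sum_distrib_right)
  finally show ?thesis .
qed

text \<open>The Moon-Moser argument: adjacent \<open>u\<close> and \<open>v\<close> have at least
  \<open>d u + d v - card W\<close> common neighbours in \<open>W\<close>; sum over the arcs and
  apply Cauchy-Schwarz to the degrees.\<close>

lemma triangles_ge_induced:
  assumes W: "W \<subseteq> V"
  defines "D \<equiv> \<Sum>u\<in>W. \<Sum>v\<in>W. e u v"
  shows "D * (2 * D - (real (card W))\<^sup>2) \<le> real (card W) * triangles"
proof -
  let ?k = "real (card W)"
  define d where "d u = (\<Sum>v\<in>W. e u v)" for u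
  have finW: "finite W" using W finite_V finite_subset by blast
  have "e u v * (d u + d v - ?k) \<le> (\<Sum>w\<in>W. e u v * (e u w * e v w))" for u v
  proof -
    have "d u + d v - ?k = (\<Sum>w\<in>W. e u w + e v w - 1)"
      by (simp add: d_def sum.distrib sum_subtractf)
    also have "\<dots> \<le> (\<Sum>w\<in>W. e u w * e v w)"
      by (intro sum_mono) auto
    finally show ?thesis
      by (auto simp flip: sum_distrib_left)
  qed
  then have "(\<Sum>u\<in>W. \<Sum>v\<in>W. e u v * (d u + d v - ?k)) \<le> (\<Sum>u\<in>W. \<Sum>v\<in>W. \<Sum>w\<in>W. e u v * (e u w * e v w))"
    by (intro sum_mono)
  also have "\<dots> \<le> (\<Sum>u\<in>W. \<Sum>v\<in>W. \<Sum>w\<in>V. e u v * (e u w * e v w))"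
    using W finite_V by (intro sum_mono sum_mono2) auto
  also have "\<dots> \<le> (\<Sum>u\<in>W. \<Sum>v\<in>V. \<Sum>w\<in>V. e u v * (e u w * e v w))"
    using W finite_V by (intro sum_mono sum_mono2 sum_nonneg) auto
  also have "\<dots> \<le> (\<Sum>u\<in>V. \<Sum>v\<in>V. \<Sum>w\<in>V. e u v * (e u w * e v w))"
    using W finite_V by (intro sum_mono2 sum_nonneg) auto
  also have "\<dots> = triangles"
    by (simp add: triangles_def codeg_def sum_distrib_left)
  finally have 1: "(\<Sum>u\<in>W. \<Sum>v\<in>W. e u v * (d u + d v - ?k)) \<le> triangles" .
  have "(\<Sum>u\<in>W. \<Sum>v\<in>W. e u v * d v) = (\<Sum>v\<in>W. \<Sum>u\<in>W. e u v * d v)"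
    by (rule sum.swap)
  also have "\<dots> = (\<Sum>v\<in>W. d v * d v)"
    unfolding sum_distrib_right[symmetric] by (simp add: d_def e_commute)
  finally have s: "(\<Sum>u\<in>W. \<Sum>v\<in>W. e u v * d v) = (\<Sum>v\<in>W. (d v)\<^sup>2)"
    by (simp add: power2_eq_square)
  have D: "D = (\<Sum>u\<in>W. d u)" by (simp add: D_def d_def)
  have "(\<Sum>u\<in>W. \<Sum>v\<in>W. e u v * (d u + d v - ?k))
      = (\<Sum>u\<in>W. \<Sum>v\<in>W. e u v * d u) + (\<Sum>u\<in>W. \<Sum>v\<in>W. e u v * d v) - (\<Sum>u\<in>W. \<Sum>v\<in>W. e u v * ?k)"
    by (simp only: ring_distribs sum.distrib sum_subtractf)
  also have "\<dots> = 2 * (\<Sum>v\<in>W. (d v)\<^sup>2) - ?k * D"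
  proof -
    have "(\<Sum>u\<in>W. \<Sum>v\<in>W. e u v * ?k) = ?k * D"
      unfolding D d_def sum_distrib_left by (simp add: mult.commute)
    moreover have "(\<Sum>u\<in>W. \<Sum>v\<in>W. e u v * d u) = (\<Sum>v\<in>W. (d v)\<^sup>2)"
      unfolding sum_distrib_right[symmetric] by (simp add: d_def power2_eq_square)
    ultimately show ?thesis unfolding s by simp
  qed
  finally have 2: "2 * (\<Sum>v\<in>W. (d v)\<^sup>2) - ?k * D \<le> triangles" using 1 by simp
  have "D\<^sup>2 \<le> (\<Sum>v\<in>W. (d v)\<^sup>2) * ?k"
    using Cauchy_Schwarz_ineq_sum[of d "\<lambda>_. 1" W] by (simp add: D)
  moreover have "?k * (2 * (\<Sum>v\<in>W. (d v)\<^sup>2) - ?k * D) \<le> ?k * triangles"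
    using 2 by (intro mult_left_mono) auto
  ultimately show ?thesis by (simp add: power2_eq_square algebra_simps)
qed

text \<open>Deleting \<open>v\<close> lowers the triangle-free maximum of \<open>arcs\<close> from
  about \<open>n^2 / 2\<close> to about \<open>(n - 1)^2 / 2\<close>, so by about \<open>n\<close>.
  A vertex of degree well below \<open>n / 2\<close> costs fewer arcs than that, and its deletion
  leaves a surplus that forces triangles.\<close>

lemma triangles_ge_delete:
  assumes v: "v \<in> V"
  defines "D \<equiv> arcs - 2 * deg v"
  shows "D * (2 * D - (real (card V) - 1)\<^sup>2) \<le> (real (card V) - 1) * triangles"
proof -
  have "arcs = (\<Sum>u\<in>V - {v}. \<Sum>w\<in>V. e u w) + deg v"
    using v finite_V by (simp add: arcs_def deg_def sum.remove)
  also have "(\<Sum>u\<in>V - {v}. \<Sum>w\<in>V. e u w) = (\<Sum>u\<in>V - {v}. (\<Sum>w\<in>V - {v}. e u w) + e u v)"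
    by (simp only: sum.remove[OF finite_V v] add.commute)
  also have "\<dots> = (\<Sum>u\<in>V - {v}. \<Sum>w\<in>V - {v}. e u w) + (\<Sum>u\<in>V - {v}. e u v)"
    by (rule sum.distrib)
  also have "(\<Sum>u\<in>V - {v}. e u v) = deg v"
    unfolding deg_def sum.remove[OF finite_V v, of "e v"]
    using adj_irrefl[of v] by (simp add: e_commute[of v] del: sum_of_bool_eq)
  finally have "D = (\<Sum>u\<in>V - {v}. \<Sum>w\<in>V - {v}. e u w)" by (simp add: D_def)
  moreover have "real (card (V - {v})) = real (card V) - 1"
    using v finite_V by (metis card_Suc_Diff1 of_nat_Suc add_diff_cancel_left')
  ultimately show ?thesis using triangles_ge_induced[of "V - {v}"] by simp
qed

end

context perron
begin

text \<open>Apply positive semidefiniteness of \<open>A + lam I\<close> to the indicator of each neighbourhood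
  with its component along the Perron vector removed.\<close>

lemma lam_cube_le: "2 * lam ^ 3 \<le> triangles + lam * arcs"
proof -
  have *: "lam ^ 3 * (x u)\<^sup>2 + lam ^ 3 * (x u)\<^sup>2 \<le> (\<Sum>v\<in>V. e u v * codeg u v) + lam * deg u" if u: "u \<in> V" for u
  proof -
    \<comment> \<open>The coefficient of \<open>e u\<close> along \<open>x\<close> is
      \<open>adj_op x u\<close>, which equals \<open>lam * x u\<close>.\<close>
    define c where "c = - (lam * x u)"
    have ex: "(\<Sum>v\<in>V. e u v * x v) = lam * x u"
      using x_eigen[OF u] by (simp add: adj_op_def)
    have "(\<Sum>v\<in>V. adj_op (e u) v * x v) = (\<Sum>v\<in>V. e u v * adj_op x v)"
      by (simp add: adj_op_symmetric)
    also have "\<dots> = (\<Sum>v\<in>V. lam * (e u v * x v))"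
      using x_eigen by (intro sum.cong) auto
    also have "\<dots> = lam\<^sup>2 * x u"
      by (simp add: sum_distrib_left[symmetric] ex power2_eq_square del: sum_of_bool_mult_eq)
    finally have 1: "(\<Sum>v\<in>V. adj_op (e u) v * x v) = lam\<^sup>2 * x u" .
    have "adj_form x = (\<Sum>v\<in>V. lam * (x v)\<^sup>2)"
      unfolding adj_form_def by (intro sum.cong refl) (simp add: x_eigen power2_eq_square)
    then have 2: "adj_form x = lam" by (simp add: sum_distrib_left[symmetric] x_unit)
    have 3: "adj_form (e u) = (\<Sum>v\<in>V. e u v * codeg u v)"
      by (simp add: adj_form_def adj_op_def codeg_def mult.commute)
    have "adj_form (\<lambda>v. e u v + c * x v) = (\<Sum>v\<in>V. e u v * codeg u v) + 2 * c * (lam\<^sup>2 * x u) + c\<^sup>2 * lam"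
      unfolding adj_form_add 1 2 3 ..
    moreover have "(\<Sum>v\<in>V. (e u v + c * x v)\<^sup>2) = deg u + 2 * c * (lam * x u) + c\<^sup>2"
    proof -
      have "(\<Sum>v\<in>V. (e u v + c * x v)\<^sup>2) = (\<Sum>v\<in>V. e u v + 2 * c * (e u v * x v) + c\<^sup>2 * (x v)\<^sup>2)"
        by (intro sum.cong) (auto simp: power2_eq_square algebra_simps)
      also have "\<dots> = deg u + 2 * c * (\<Sum>v\<in>V. e u v * x v) + c\<^sup>2 * (\<Sum>v\<in>V. (x v)\<^sup>2)"
        unfolding sum.distrib deg_def sum_distrib_left ..
      finally show ?thesis by (simp add: ex x_unit)
    qed
    ultimately have "- lam * (deg u + 2 * c * (lam * x u) + c\<^sup>2)
        \<le> (\<Sum>v\<in>V. e u v * codeg u v) + 2 * c * (lam\<^sup>2 * x u) + c\<^sup>2 * lam"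
      using form_ge[of "\<lambda>v. e u v + c * x v"] by simp
    then show ?thesis
      by (simp add: c_def power2_eq_square power3_eq_cube algebra_simps)
  qed
  have "(\<Sum>u\<in>V. lam ^ 3 * (x u)\<^sup>2 + lam ^ 3 * (x u)\<^sup>2)
      \<le> (\<Sum>u\<in>V. (\<Sum>v\<in>V. e u v * codeg u v) + lam * deg u)"
    by (intro sum_mono *)
  also have "\<dots> = triangles + lam * arcs"
    by (simp only: sum.distrib triangles_def arcs_def sum_distrib_left)
  also have "(\<Sum>u\<in>V. lam ^ 3 * (x u)\<^sup>2 + lam ^ 3 * (x u)\<^sup>2) = 2 * lam ^ 3"
    by (simp add: sum.distrib sum_distrib_left[symmetric] x_unit)
  finally show ?thesis .
qed

end

section \<open>Quantitative bounds on edges and degrees when triangular edges are few\<close>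

locale few_triangular_edges = perron +
  fixes n f :: nat
  assumes card_V: "card V = n" and n_large: "n \<ge> 5432" and f_def: "f = n div 2"
    and lam_ge: "lam\<^sup>2 \<ge> real f * (real n - real f)"
    and tarcs_le: "tarcs \<le> 4 * real f - 4"
begin

abbreviation N :: real where "N \<equiv> real n"

lemma N_ge: "N \<ge> 5432" using n_large by simp

lemma f_bounds: "2 * real f \<le> N" "N \<le> 2 * real f + 1"
  using f_def by linarith+

lemma tarcs_le': "tarcs \<le> 2 * N - 4"
  using tarcs_le f_bounds by linarith

lemma lam_ge_f: "lam \<ge> real f"
proof -
  have "(real f)\<^sup>2 \<le> real f * (N - real f)"
    unfolding power2_eq_square using f_bounds by (intro mult_left_mono) auto
  then have "(real f)\<^sup>2 \<le> lam\<^sup>2" using lam_ge by linarith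
  then show ?thesis using lam_nonneg by (rule power2_le_imp_le)
qed

lemma lam_ge_N: "2 * lam \<ge> N - 1"
  using lam_ge_f f_bounds by linarith

lemma lam_sq_ge: "4 * lam\<^sup>2 \<ge> N\<^sup>2 - 1"
proof -
  have "(N - 2 * real f)\<^sup>2 \<le> 1"
    using f_bounds by (intro power_le_one) auto
  then have "4 * (real f * (N - real f)) \<ge> N\<^sup>2 - 1"
    by (simp add: power2_eq_square algebra_simps)
  then show ?thesis using lam_ge by linarith
qed

lemma triangles_le_N: "26 * triangles \<le> N\<^sup>2"
proof -
  \<comment> \<open>52 is the largest integer whose doubled square is at most 5432.\<close>
  have "sqrt tarcs \<le> N / 52"
  proof (rule real_le_lsqrt)
    have "5432 * N \<le> N * N" using N_ge by (intro mult_right_mono) auto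
    then show "tarcs \<le> (N / 52)\<^sup>2" using tarcs_le' by (simp add: power2_eq_square)
  qed (use tarcs_nonneg in auto)
  then have "tarcs * sqrt tarcs \<le> (2 * N) * (N / 52)"
    using tarcs_le' tarcs_nonneg by (intro mult_mono) auto
  then show ?thesis using triangles_le by (simp add: power2_eq_square)
qed

text \<open>After division by \<open>lam\<close>, the triangles in \<open>lam_cube_le\<close> are
  worth about \<open>n / 13\<close> arcs. The proof uses \<open>77 / 1000\<close>, just above
  \<open>1 / 13\<close>; the remaining \<open>n / 10000\<close> absorbs the \<open>1 / 2\<close>
  lost in \<open>lam_sq_ge\<close>.\<close>

lemma arcs_ge: "arcs \<ge> N\<^sup>2 / 2 - 771 / 10000 * N"
proof (rule ccontr)
  assume "\<not> ?thesis"
  then have "2 * lam\<^sup>2 - arcs \<ge> 77 / 1000 * N" using lam_sq_ge N_ge by linarith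
  then have "lam * (77 / 1000 * N) \<le> lam * (2 * lam\<^sup>2 - arcs)"
    using lam_nonneg by (intro mult_left_mono)
  also have "\<dots> \<le> triangles"
    using lam_cube_le by (simp add: power2_eq_square power3_eq_cube algebra_simps)
  finally have "26 * (lam * (77 / 1000 * N)) \<le> N\<^sup>2" using triangles_le_N by linarith
  moreover have "(N - 1) / 2 * (77 / 1000 * N) \<le> lam * (77 / 1000 * N)"
    using lam_ge_N N_ge by (intro mult_right_mono) auto
  ultimately have "N * (26 * ((N - 1) / 2 * (77 / 1000))) \<le> N * N"
    by (simp add: power2_eq_square algebra_simps)
  then have "26 * ((N - 1) / 2 * (77 / 1000)) \<le> N" using N_ge by (simp add: mult_le_cancel_left)
  then show False using N_ge by (simp add: field_simps)
qed

text \<open>Deleting a vertex of smaller degree leaves a surplus \<open>2 * D - (N - 1)^2\<close> of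
  at least \<open>0.085 * N\<close>. This forces more than \<open>N^2 / 26\<close> triangles,
  because \<open>0.499 * 0.085 > 1 / 26\<close>. In the bound on \<open>D\<close>,
  \<open>9571 = 771 + 2 * 4400\<close>.\<close>

lemma deg_ge:
  assumes v: "v \<in> V"
  shows "deg v \<ge> 44 / 100 * N"
proof (rule ccontr)
  assume less: "\<not> ?thesis"
  define D where "D = arcs - 2 * deg v"
  have D: "D \<ge> N\<^sup>2 / 2 - 9571 / 10000 * N" using less arcs_ge unfolding D_def by linarith
  have NN: "5432 * N \<le> N\<^sup>2" unfolding power2_eq_square using N_ge by (intro mult_right_mono) auto
  have D1: "D \<ge> 499 / 1000 * N\<^sup>2" using D NN N_ge by linarith
  have "(N - 1)\<^sup>2 = N\<^sup>2 - 2 * N + 1" by (simp add: power2_eq_square algebra_simps)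
  then have D2: "2 * D - (N - 1)\<^sup>2 \<ge> 85 / 1000 * N" using D N_ge by linarith
  have "(499 / 1000 * N\<^sup>2) * (85 / 1000 * N) \<le> D * (2 * D - (N - 1)\<^sup>2)"
    using D1 D2 N_ge order_trans[OF _ D1, of 0] by (intro mult_mono) auto
  also have "\<dots> \<le> (N - 1) * triangles"
    using triangles_ge_delete[OF v] by (simp add: D_def card_V)
  also have "\<dots> \<le> (N - 1) * (N\<^sup>2 / 26)"
    using triangles_le_N N_ge by (intro mult_left_mono) auto
  also have "\<dots> \<le> N * (N\<^sup>2 / 26)" using N_ge by (intro mult_right_mono) auto
  finally have "N * N\<^sup>2 * (499 / 1000 * (85 / 1000)) \<le> N * N\<^sup>2 * (1 / 26)" by (simp add: mult_ac)
  then have "(499 / 1000 * (85 / 1000)) \<le> (1 / 26 :: real)"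
    using N_ge by (subst (asm) mult_le_cancel_left_pos) auto
  then show False by simp
qed

end

section \<open>A nearly bipartite structure\<close>

context simple_graph
begin

definition deg_in :: "'a set \<Rightarrow> 'a \<Rightarrow> real" where
  "deg_in W u = (\<Sum>v\<in>W. e u v)"

lemma deg_in_V: "deg_in V u = deg u"
  by (simp only: deg_in_def deg_def)

lemma deg_in_nonneg: "deg_in W u \<ge> 0"
  unfolding deg_in_def by (rule sum_nonneg) simp

lemma deg_in_le_card: "deg_in W u \<le> real (card W)"
proof -
  have "deg_in W u \<le> (\<Sum>v\<in>W. 1)" unfolding deg_in_def by (rule sum_mono) simp
  then show ?thesis by simp
qed

lemma deg_in_Diff:
  assumes "U \<subseteq> W" "W \<subseteq> V"
  shows "deg_in W u = deg_in U u + deg_in (W - U) u"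
  unfolding deg_in_def using assms finite_V finite_subset
  by (metis sum.subset_diff add.commute)

lemma deg_in_mono:
  assumes "U \<subseteq> W" "W \<subseteq> V"
  shows "deg_in U u \<le> deg_in W u"
  using deg_in_Diff[OF assms, of u] deg_in_nonneg[of "W - U" u] by simp

lemma sum_deg_in_swap: "(\<Sum>u\<in>X. deg_in Y u) = (\<Sum>v\<in>Y. deg_in X v)"
  unfolding deg_in_def by (subst sum.swap) (simp only: e_commute)

lemma deg_in_inter_ge:
  "deg_in W u + deg_in W v - real (card W) \<le> (\<Sum>w\<in>W. e u w * e v w)"
proof -
  have "deg_in W u + deg_in W v - real (card W) = (\<Sum>w\<in>W. e u w + e v w - 1)"
    by (simp add: deg_in_def sum.distrib sum_subtractf del: sum_of_bool_eq)
  also have "\<dots> \<le> (\<Sum>w\<in>W. e u w * e v w)"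
    by (intro sum_mono) auto
  finally show ?thesis .
qed

definition independent :: "'a set \<Rightarrow> bool" where
  "independent W \<longleftrightarrow> W \<subseteq> V \<and> (\<forall>u\<in>W. \<forall>v\<in>W. \<not> adj u v)"

lemma ex_max_independent:
  obtains A where "independent A" "\<And>W. independent W \<Longrightarrow> card W \<le> card A"
proof -
  have "independent {}" by (simp add: independent_def)
  moreover have "card W < Suc (card V)" if "independent W" for W
    using that finite_V by (simp add: independent_def card_mono less_Suc_eq_le)
  ultimately obtain A where "independent A \<and> (\<forall>W. independent W \<longrightarrow> card W \<le> card A)"
    using ex_has_greatest_nat[of independent "{}" card "Suc (card V)"] by blast
  then show ?thesis using that by blast
qed

text \<open>The neighbours of \<open>w\<close> along non-triangular edges are independent, since an
  edge between two of them would close a triangle with \<open>w\<close>.\<close>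

lemma deg_le_independent:
  assumes max: "\<And>W. independent W \<Longrightarrow> card W \<le> card A"
  shows "deg w \<le> real (card A) + tdeg w"
proof -
  define W where "W = {v \<in> V. adj w v \<and> \<not> tri w v}"
  have "independent W"
    unfolding independent_def W_def tri_def by auto
  then have "card W \<le> card A" by (rule max)
  have "deg w = (\<Sum>v\<in>V. of_bool (v \<in> W) + t w v)"
    unfolding deg_def by (intro sum.cong) (auto simp: W_def tri_def)
  also have "\<dots> = (\<Sum>v\<in>V. of_bool (v \<in> W)) + tdeg w"
    by (simp only: sum.distrib tdeg_def)
  also have "(\<Sum>v\<in>V. of_bool (v \<in> W) :: real) = real (card W)"
    using finite_V by (simp add: W_def Int_def conj_commute)
  finally show ?thesis using \<open>card W \<le> card A\<close> by simp
qed

text \<open>Endpoints are collected rather than edges, so that sums of \<open>tdeg\<close> bound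
  their number; two endpoints mean a single inner edge.\<close>

definition inner :: "'a set \<Rightarrow> 'a set" where
  "inner A = {u \<in> V. \<exists>v. adj u v \<and> (u \<in> A \<longleftrightarrow> v \<in> A)}"

definition opposite :: "'a set \<Rightarrow> 'a \<Rightarrow> 'a set" where
  "opposite A u = (if u \<in> A then V - A else A)"

lemma sum_tri_ge_deg_in:
  assumes "adj u v" "opposite A u = opposite A v"
  shows "deg_in (opposite A u) u + deg_in (opposite A u) v - real (card (opposite A u))
    \<le> (\<Sum>w\<in>opposite A u. t u w)"
proof -
  have "(\<Sum>w\<in>opposite A u. e u w * e v w) \<le> (\<Sum>w\<in>opposite A u. t u w)"
  proof (rule sum_mono)
    fix w
    have "tri u w" if "adj u w" "adj v w"
      unfolding tri_def using that assms(1) adj_sym by blast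
    then show "e u w * e v w \<le> t u w" by auto
  qed
  then show ?thesis using deg_in_inter_ge[of "opposite A u" u v] by linarith
qed

lemma deg_le_inner:
  assumes "A \<subseteq> V" "u \<in> V"
  shows "deg u \<le> deg_in (opposite A u) u + real (card (inner A))"
proof -
  define S where "S = V - opposite A u"
  have opp: "opposite A u \<subseteq> V" using assms by (auto simp: opposite_def)
  have "deg_in S u = (\<Sum>v\<in>S. of_bool (adj u v))" by (simp only: deg_in_def)
  also have "\<dots> \<le> (\<Sum>v\<in>S. of_bool (v \<in> inner A))"
  proof (rule sum_mono)
    fix v assume "v \<in> S"
    have "v \<in> inner A" if "adj u v"
      using \<open>v \<in> S\<close> that adj_sym[of u v] assms by (auto simp: S_def inner_def opposite_def split: if_splits)
    then show "of_bool (adj u v) \<le> (of_bool (v \<in> inner A) :: real)" by auto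
  qed
  also have "\<dots> = real (card (S \<inter> inner A))"
    using finite_V by (simp add: S_def Int_def conj_commute)
  also have "\<dots> \<le> real (card (inner A))"
    using finite_V by (simp add: inner_def card_mono)
  finally show ?thesis
    using deg_in_Diff[OF opp subset_refl, of u] by (simp add: S_def deg_in_V)
qed

lemma sum_tri_le_tdeg:
  assumes "W \<subseteq> V"
  shows "(\<Sum>w\<in>W. t u w) \<le> tdeg u"
  unfolding tdeg_def using assms finite_V by (intro sum_mono2) auto

lemma sum_tdeg_le_tarcs:
  assumes "W \<subseteq> V"
  shows "(\<Sum>u\<in>W. tdeg u) \<le> tarcs"
  unfolding tarcs_def using assms finite_V tdeg_nonneg by (intro sum_mono2) auto

text \<open>The \<open>k\<close> triangular arcs leaving each vertex of \<open>J\<close> are counted in both directions; the at most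
  \<open>9\<close> arcs within \<open>J\<close> are the overlap.\<close>

lemma tarcs_ge_3:
  assumes J: "J \<subseteq> V" "card J = 3" and k: "\<And>u. u \<in> J \<Longrightarrow> k \<le> tdeg u"
  shows "6 * k - 9 \<le> tarcs"
proof -
  have finJ: "finite J" using J finite_V finite_subset by blast
  have "k - 3 \<le> (\<Sum>c\<in>V - J. t c u)" if "u \<in> J" for u
  proof -
    have "tdeg u = (\<Sum>c\<in>V - J. t u c) + (\<Sum>c\<in>J. t u c)"
      unfolding tdeg_def by (rule sum.subset_diff[OF J(1) finite_V])
    moreover have "(\<Sum>c\<in>J. t u c) \<le> (\<Sum>c\<in>J. 1)" by (rule sum_mono) simp
    moreover have "(\<Sum>c\<in>J. 1) = (3::real)" using J by simp
    moreover have "(\<Sum>c\<in>V - J. t u c) = (\<Sum>c\<in>V - J. t c u)"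
      by (intro sum.cong refl) (use tri_sym in \<open>simp, blast\<close>)
    ultimately show ?thesis using k[OF that] by linarith
  qed
  then have "(\<Sum>u\<in>J. k - 3) \<le> (\<Sum>u\<in>J. \<Sum>c\<in>V - J. t c u)" by (intro sum_mono)
  also have "\<dots> = (\<Sum>c\<in>V - J. \<Sum>u\<in>J. t c u)" by (rule sum.swap)
  also have "\<dots> \<le> (\<Sum>c\<in>V - J. tdeg c)" by (intro sum_mono sum_tri_le_tdeg J)
  finally have "3 * (k - 3) \<le> (\<Sum>c\<in>V - J. tdeg c)" using J by simp
  moreover have "(\<Sum>u\<in>J. k) \<le> (\<Sum>u\<in>J. tdeg u)" by (intro sum_mono k)
  then have "3 * k \<le> (\<Sum>u\<in>J. tdeg u)" using J by simp
  moreover have "tarcs = (\<Sum>c\<in>V - J. tdeg c) + (\<Sum>u\<in>J. tdeg u)"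
    unfolding tarcs_def by (rule sum.subset_diff[OF J(1) finite_V])
  ultimately show ?thesis by argo
qed

end

context few_triangular_edges
begin

text \<open>A bootstrap. The assumed cross degrees give each inner vertex \<open>0.35 * N\<close>
  triangular arcs, so there are at most six inner vertices. A vertex then has at most six neighbours
  in its own part, which raises the cross degrees to \<open>0.4388 * N\<close> and the triangular
  arcs to \<open>0.3566 * N\<close>. This exceeds \<open>N / 3\<close>, the threshold at which
  \<open>tarcs_ge_3\<close> excludes three inner vertices.\<close>

lemma card_inner_le_2:
  assumes A: "A \<subseteq> V"
    and size: "real (card A) \<le> 521 / 1000 * N" "real (card (V - A)) \<le> 521 / 1000 * N"
    and cross: "\<And>u. u \<in> V \<Longrightarrow> deg_in (opposite A u) u \<ge> 4355 / 10000 * N"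
  shows "card (inner A) \<le> 2"
proof -
  have opp: "opposite A u \<subseteq> V" "real (card (opposite A u)) \<le> 521 / 1000 * N" for u
    using A size by (auto simp: opposite_def)
  have inV: "inner A \<subseteq> V" and fin: "finite (inner A)"
    using finite_V by (auto simp: inner_def)
  have tdeg: "2 * d - 521 / 1000 * N \<le> tdeg u"
    if u: "u \<in> inner A" and d: "\<And>u. u \<in> V \<Longrightarrow> deg_in (opposite A u) u \<ge> d" for u d
  proof -
    obtain v where v: "adj u v" "u \<in> A \<longleftrightarrow> v \<in> A" and "u \<in> V"
      using u by (auto simp: inner_def)
    have "v \<in> V" using v adj_sym adj_V by blast
    have eq: "opposite A u = opposite A v" using v by (simp add: opposite_def)
    show ?thesis
      using sum_tri_ge_deg_in[OF v(1) eq] sum_tri_le_tdeg[OF opp(1), of u u] opp(2)[of u]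
        d[OF \<open>u \<in> V\<close>] d[OF \<open>v \<in> V\<close>, folded eq] by linarith
  qed
  have "(\<Sum>u\<in>inner A. 35 / 100 * N) \<le> (\<Sum>u\<in>inner A. tdeg u)"
    by (intro sum_mono) (use tdeg[OF _ cross] in force)
  also have "\<dots> \<le> 2 * N" using sum_tdeg_le_tarcs[OF inV] tarcs_le' by linarith
  finally have "N * (real (card (inner A)) * (35 / 100)) \<le> N * 2" by (simp add: mult_ac)
  then have "real (card (inner A)) * (35 / 100) \<le> 2"
    using N_ge by (subst (asm) mult_le_cancel_left_pos) auto
  then have c6: "real (card (inner A)) \<le> 6" by linarith
  have cross2: "deg_in (opposite A u) u \<ge> 4388 / 10000 * N" if "u \<in> V" for u
    using deg_ge[OF that] deg_le_inner[OF A that] c6 N_ge by linarith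
  show ?thesis
  proof (rule ccontr)
    assume "\<not> ?thesis"
    then obtain J where J: "J \<subseteq> inner A" "card J = 3"
      using obtain_subset_with_card_n[of 3 "inner A"] by auto
    have "6 * (2 * (4388 / 10000 * N) - 521 / 1000 * N) - 9 \<le> tarcs"
      by (rule tarcs_ge_3[of J]) (use J inV tdeg[OF _ cross2] in auto)
    then show False using tarcs_le' N_ge by argo
  qed
qed

text \<open>A maximum independent set is nearly one side of the bipartition: few of its pairs with the
  complement \<open>R\<close> are non-adjacent, and each vertex of \<open>R\<close> has few neighbours on one of the two
  sides.\<close>

lemma ex_near_bipartition:
  obtains A where "A \<subseteq> V" "card (inner A) \<le> 2"
proof -
  obtain A where A: "independent A" "\<And>W. independent W \<Longrightarrow> card W \<le> card A"
    using ex_max_independent by blast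
  have AV: "A \<subseteq> V" and finA: "finite A" using A finite_V finite_subset by (auto simp: independent_def)
  define R where "R = V - A"
  have RV: "R \<subseteq> V" and finR: "finite R" using finite_V by (auto simp: R_def)
  define a where "a = real (card A)"
  define r where "r = real (card R)"
  have "a + r = real (card V)"
    using card_Diff_subset[OF finA AV] card_mono[OF finite_V AV] by (simp add: a_def r_def R_def)
  then have ar: "a + r = N" by (simp add: card_V)
  have degAR: "deg u = deg_in A u + deg_in R u" for u
    using deg_in_Diff[OF AV subset_refl] by (simp add: deg_in_V R_def)
  have degA: "deg_in A u = 0" if "u \<in> A" for u
    using A that by (auto simp: deg_in_def independent_def)
  define X where "X = (\<Sum>w\<in>R. deg_in A w)"
  define Y where "Y = (\<Sum>w\<in>R. deg_in R w)"
  have Y0: "Y \<ge> 0" unfolding Y_def by (intro sum_nonneg deg_in_nonneg)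
  have "(\<Sum>u\<in>A. deg u) = (\<Sum>u\<in>A. deg_in R u)"
    by (intro sum.cong) (simp_all add: degAR degA)
  also have "\<dots> = X" unfolding X_def by (rule sum_deg_in_swap)
  finally have sA: "(\<Sum>u\<in>A. deg u) = X" .
  have sR: "(\<Sum>u\<in>R. deg u) = X + Y" by (simp add: degAR sum.distrib X_def Y_def)
  have "arcs = (\<Sum>u\<in>R. deg u) + (\<Sum>u\<in>A. deg u)"
    unfolding arcs_def R_def by (rule sum.subset_diff[OF AV finite_V])
  then have arcs: "arcs = 2 * X + Y" using sA sR by simp
  have "(\<Sum>u\<in>R. deg u) \<le> (\<Sum>u\<in>R. a + tdeg u)"
    unfolding a_def by (intro sum_mono deg_le_independent A)
  also have "\<dots> = a * r + (\<Sum>u\<in>R. tdeg u)" by (simp add: sum.distrib r_def)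
  also have "\<dots> \<le> a * r + 2 * N" using sum_tdeg_le_tarcs[OF RV] tarcs_le' by linarith
  finally have XY: "X + Y \<le> a * r + 2 * N" using sR by simp
  have sq: "(a - r)\<^sup>2 = N\<^sup>2 - 4 * (a * r)" unfolding ar[symmetric] by (simp add: power2_eq_square algebra_simps)
  have arle: "4 * (a * r) \<le> N\<^sup>2" using sq zero_le_power2[of "a - r"] by linarith
  define M where "M = a * r - X"
  \<comment> \<open>\<open>M\<close> counts the non-adjacent pairs between \<open>A\<close> and
    \<open>R\<close>. From \<open>arcs = X + (X + Y)\<close> and \<open>XY\<close> it is at most
    \<open>2 * a * r - N^2 / 2 + 2.0771 * N\<close>.\<close>
  have M: "M \<le> 20771 / 10000 * N" using arcs XY arcs_ge arle unfolding M_def by linarith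
  have dif: "(a - r)\<^sup>2 \<le> 82 / 10 * N" using sq arcs XY arcs_ge Y0 N_ge by linarith
  have "\<bar>a - r\<bar> \<le> 4 / 100 * N"
  proof (rule power2_le_imp_le)
    have "5432 * N \<le> N\<^sup>2" unfolding power2_eq_square using N_ge by (intro mult_right_mono) auto
    then show "\<bar>a - r\<bar>\<^sup>2 \<le> (4 / 100 * N)\<^sup>2" using dif by (simp add: power_mult_distrib power_divide)
  qed (use N_ge in auto)
  then have size: "a \<le> 52 / 100 * N" "r \<le> 52 / 100 * N" "a \<ge> 48 / 100 * N"
    using ar by linarith+
  have Msum: "M = (\<Sum>w\<in>R. a - deg_in A w)"
    by (simp add: M_def X_def sum_subtractf r_def)
  \<comment> \<open>A neighbour of \<open>w\<close> in \<open>R\<close> and one in \<open>A\<close>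
    form either a missing pair or a triangular arc, so the product of the two degrees is at most
    \<open>4.1 * N\<close>. If both were at least 19, the larger would be at least
    \<open>0.22 * N\<close> and the product at least \<open>4.18 * N\<close>.\<close>
  have small: "deg_in A w < 19 \<or> deg_in R w < 19" if w: "w \<in> R" for w
  proof (rule ccontr)
    assume *: "\<not> ?thesis"
    have "deg_in R w * deg_in A w = (\<Sum>v\<in>R. \<Sum>c\<in>A. e w v * e w c)"
      unfolding deg_in_def by (rule sum_product)
    also have "\<dots> \<le> (\<Sum>v\<in>R. \<Sum>c\<in>A. (1 - e v c) + t v c)"
    proof (intro sum_mono)
      fix v c
      have "tri v c" if "adj w v" "adj w c" "adj v c"
        unfolding tri_def using that adj_sym by blast
      then show "e w v * e w c \<le> (1 - e v c) + t v c" by auto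
    qed
    also have "\<dots> = (\<Sum>v\<in>R. (a - deg_in A v) + (\<Sum>c\<in>A. t v c))"
      by (simp add: sum.distrib sum_subtractf a_def deg_in_def del: sum_of_bool_eq)
    also have "\<dots> = M + (\<Sum>v\<in>R. \<Sum>c\<in>A. t v c)"
      by (simp only: sum.distrib Msum)
    also have "(\<Sum>v\<in>R. \<Sum>c\<in>A. t v c) \<le> (\<Sum>v\<in>R. tdeg v)"
      by (intro sum_mono sum_tri_le_tdeg AV)
    also have "\<dots> \<le> 2 * N" using sum_tdeg_le_tarcs[OF RV] tarcs_le' by linarith
    finally have le: "deg_in R w * deg_in A w \<le> 41 / 10 * N" using M N_ge by linarith
    have "deg_in A w + deg_in R w \<ge> 44 / 100 * N" using deg_ge degAR w RV by auto
    then consider "deg_in R w \<ge> 22 / 100 * N" | "deg_in A w \<ge> 22 / 100 * N" by linarith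
    then have "(22 / 100 * N) * 19 \<le> deg_in R w * deg_in A w"
    proof cases
      case 1
      then show ?thesis using * by (intro mult_mono deg_in_nonneg) auto
    next
      case 2
      then have "19 * (22 / 100 * N) \<le> deg_in R w * deg_in A w"
        using * N_ge by (intro mult_mono deg_in_nonneg) auto
      then show ?thesis by (simp add: mult_ac)
    qed
    then show False using le N_ge by simp
  qed
  \<comment> \<open>Each of these misplaced vertices uses up at least \<open>0.4765 * N\<close> of
    the missing pairs, so at most five are moved to the side of \<open>A\<close>. The sizes stay
    below \<open>0.52 * N + 5\<close> and the cross degrees above \<open>0.44 * N - 24\<close>; this
    is the origin of \<open>0.521\<close> and \<open>0.4355\<close>.\<close>
  define P where "P = {w \<in> R. deg_in A w < 19}"
  have PR: "P \<subseteq> R" by (auto simp: P_def)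
  have "(\<Sum>w\<in>P. 4765 / 10000 * N) \<le> (\<Sum>w\<in>P. a - deg_in A w)"
  proof (rule sum_mono)
    fix w assume "w \<in> P"
    then show "4765 / 10000 * N \<le> a - deg_in A w" using size N_ge by (simp add: P_def)
  qed
  also have "\<dots> \<le> M"
    unfolding Msum using PR finR deg_in_le_card by (intro sum_mono2) (auto simp: a_def)
  finally have "N * (real (card P) * (4765 / 10000)) \<le> N * (20771 / 10000)" using M by (simp add: mult_ac)
  then have "real (card P) * (4765 / 10000) \<le> 20771 / 10000"
    using N_ge by (subst (asm) mult_le_cancel_left_pos) auto
  then have p: "real (card P) \<le> 5" by linarith
  define A' where "A' = A \<union> P"
  have A'V: "A' \<subseteq> V" using AV PR RV by (auto simp: A'_def)
  have VA': "V - A' = R - P" by (auto simp: A'_def R_def)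
  have dP: "deg_in P u \<le> 5" for u using deg_in_le_card[of P u] p by linarith
  have dRP: "deg_in R u = deg_in P u + deg_in (R - P) u" for u by (rule deg_in_Diff[OF PR RV])
  have "card (inner A') \<le> 2"
  proof (rule card_inner_le_2[OF A'V])
    have "real (card A') \<le> a + real (card P)"
      using card_Un_le[of A P] by (simp add: A'_def a_def)
    then show "real (card A') \<le> 521 / 1000 * N" using size p N_ge by linarith
    have "card (R - P) \<le> card R" by (rule card_mono[OF finR]) auto
    then show "real (card (V - A')) \<le> 521 / 1000 * N" unfolding VA' using size N_ge by (simp add: r_def)
  next
    fix u assume u: "u \<in> V"
    note d = deg_ge[OF u] degAR[of u]
    consider "u \<in> A" | "u \<in> P" | "u \<in> R - P" using u by (auto simp: R_def)
    then show "deg_in (opposite A' u) u \<ge> 4355 / 10000 * N"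
    proof cases
      case 1
      then have "opposite A' u = R - P" unfolding opposite_def VA' by (simp add: A'_def)
      then show ?thesis using d degA[OF 1] dRP[of u] dP[of u] N_ge by simp
    next
      case 2
      then have "opposite A' u = R - P" "deg_in A u < 19"
        unfolding opposite_def VA' by (simp_all add: A'_def P_def)
      then show ?thesis using d dRP[of u] dP[of u] N_ge by simp
    next
      case 3
      then have "opposite A' u = A'" "deg_in R u < 19"
        using small[of u] by (auto simp: opposite_def A'_def P_def R_def)
      moreover have "deg_in A u \<le> deg_in A' u" by (rule deg_in_mono) (use A'V in \<open>auto simp: A'_def\<close>)
      ultimately show ?thesis using d N_ge by simp
    qed
  qed
  then show ?thesis using that A'V by blast
qed

end

section \<open>Excluding the last inner edge\<close>

lemma balanced_product:
  fixes a b n :: nat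
  assumes "a + b = n" "a * b \<ge> (n div 2) * (n - n div 2)"
  shows "(a = n div 2 \<or> b = n div 2) \<and> a * b = (n div 2) * (n - n div 2)"
proof -
  define f where "f = n div 2"
  define g where "g = n - f"
  have fg: "f + g = n" "f \<le> g" "g \<le> f + 1" by (auto simp: f_def g_def)
  have *: "a' * b' < f * g" if sum: "a' + b' = n" and less: "a' < f" for a' b' :: nat
  proof -
    obtain k where k: "f = a' + Suc k" using less less_iff_Suc_add by auto
    have "b' = g + Suc k" using fg sum k by linarith
    moreover have "a' < g" using less fg(2) by linarith
    then have "a' * Suc k < g * Suc k" by (rule mult_less_mono1) simp
    ultimately show ?thesis by (simp add: k algebra_simps)
  qed
  have "\<not> a < f" using *[of a b] assms by (auto simp: f_def g_def)
  moreover have "\<not> b < f" using *[of b a] assms by (auto simp: f_def g_def mult.commute)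
  ultimately have "a = f \<or> b = f" using assms(1) fg by linarith
  then show ?thesis using assms(1) fg by (auto simp: f_def g_def mult.commute)
qed

text \<open>With \<open>a = f + j\<close>, the quantity \<open>s\<close> is at least \<open>j\<^sup>2 + j + f - c\<close> for even \<open>n\<close> and \<open>j\<^sup>2 + f - c\<close>
  for odd \<open>n\<close>. The second bound is an equality for \<open>n = 2 f\<close>, \<open>a = lam = f\<close>, \<open>c = f - 2\<close>, so the
  eigenvector sums below have to produce a strict inequality.\<close>

lemma unbalanced_bound:
  fixes a c f n :: nat and lam :: real
  assumes "f \<ge> 2" "f = n div 2" "c + 2 \<le> f" "a \<le> n" "lam \<ge> real f"
    and lam2: "lam\<^sup>2 \<ge> real f * (real n - real f)"
  defines "s \<equiv> lam\<^sup>2 - real a * (real n - real a) + real a - real c"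
  shows "s > 0" and "(lam - 1) * s \<ge> real a + real c" and "a \<noteq> c \<or> (lam - 1) * s > real a + real c"
proof -
  define j where "j = int a - int f"
  define J where "J = real_of_int j"
  define g where "g = real f - 2 - real c"
  have a: "real a = real f + J" by (simp add: J_def j_def)
  have g: "g \<ge> 0" using assms(3) by (simp add: g_def)
  have c: "real c = real f - 2 - g" by (simp add: g_def)
  \<comment> \<open>Integrality of \<open>j\<close> matters: each product is negative for some reals
    between -1 and 1.\<close>
  have "0 \<le> j * (j - 1)" "0 \<le> j * (j + 1)"
    by (auto simp: zero_le_mult_iff)
  then have "0 \<le> real_of_int (j * (j - 1))" "0 \<le> real_of_int (j * (j + 1))"
    by (simp_all only: of_int_0_le_iff)
  then have jj: "J \<le> J\<^sup>2" "0 \<le> J\<^sup>2 + J"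
    by (simp_all add: J_def power2_eq_square algebra_simps)
  have "n = 2 * f \<or> n = 2 * f + 1"
    using assms(2) by linarith
  then have "real n = 2 * real f \<or> real n = 2 * real f + 1"
    by auto
  then have s: "s \<ge> J\<^sup>2 + J + 2 + g \<and> real n = 2 * real f \<or> s \<ge> J\<^sup>2 + 2 + g"
  proof
    assume n: "real n = 2 * real f"
    then have "s \<ge> J\<^sup>2 + J + 2 + g"
      using lam2 unfolding s_def a c n by (simp add: power2_eq_square algebra_simps)
    then show ?thesis using n by simp
  next
    assume n: "real n = 2 * real f + 1"
    then have "s \<ge> J\<^sup>2 + 2 + g"
      using lam2 unfolding s_def a c n by (simp add: power2_eq_square algebra_simps)
    then show ?thesis by simp
  qed
  have s2: "s \<ge> 2 + g" using s jj zero_le_power2[of J] by linarith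
  then show "s > 0" using g by linarith
  have f1: "real f - 1 \<ge> 1" using assms(1) by linarith
  have "(lam - 1) * s \<ge> (real f - 1) * s"
    using assms(5) s2 g by (intro mult_right_mono) auto
  moreover have "(real f - 1) * (s - 2) \<ge> 1 * (s - 2)"
    using f1 s2 g by (intro mult_right_mono) auto
  ultimately have "(lam - 1) * s \<ge> 2 * real f - 4 + s" by (simp add: algebra_simps)
  then have K: "(lam - 1) * s - (real a + real c) \<ge> s - J - 2 + g"
    unfolding a c by linarith
  have "s - J - 2 \<ge> 0" using s jj g zero_le_power2[of J] by linarith
  with K g show "(lam - 1) * s \<ge> real a + real c" by linarith
  show "a \<noteq> c \<or> (lam - 1) * s > real a + real c"
  proof (cases "a = c")
    case True
    then have "J \<le> -2" using a c g by linarith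
    then show ?thesis using K s2 g by linarith
  qed simp
qed

context few_triangular_edges
begin

lemma card_Diff_A:
  assumes "A \<subseteq> V"
  shows "card A + card (V - A) = n"
  using assms card_V finite_V by (metis card_Diff_subset card_mono finite_subset le_add_diff_inverse)

text \<open>Without triangles \<open>lam_cube_le\<close> becomes \<open>2 * lam^2 <= arcs\<close>.
  Hence \<open>f * (n - f) <= lam^2 <= X <= card A * card B\<close>, and the last product is at most
  \<open>f * (n - f)\<close>, so equality holds throughout and no cross pair is missing.\<close>

lemma complete_bipartite_if_no_inner:
  assumes A: "A \<subseteq> V" and inner: "inner A = {}"
  shows "card A = f \<or> card (V - A) = f" "\<And>u v. u \<in> A \<Longrightarrow> v \<in> V - A \<Longrightarrow> adj u v"
proof -
  define B where "B = V - A"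
  have bip: "(u \<in> A) \<noteq> (v \<in> A)" if "adj u v" for u v
    using inner adj_V[OF that] that by (auto simp: inner_def)
  have "e u v * (e u w * e v w) = 0" for u v w
  proof -
    have "\<not> (adj u v \<and> adj u w \<and> adj v w)" using bip by blast
    then show ?thesis by auto
  qed
  then have "triangles = 0"
    unfolding triangles_def codeg_def sum_distrib_left by (intro sum.neutral ballI)
  then have "lam * (2 * lam\<^sup>2) \<le> lam * arcs"
    using lam_cube_le by (simp add: power2_eq_square power3_eq_cube mult_ac)
  moreover have "lam > 0" using lam_ge_N N_ge by linarith
  ultimately have 1: "2 * lam\<^sup>2 \<le> arcs" by simp
  have card: "card A + card B = n" unfolding B_def by (rule card_Diff_A[OF A])
  define X where "X = (\<Sum>u\<in>A. deg_in B u)"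
  have "arcs = (\<Sum>u\<in>B. deg u) + (\<Sum>u\<in>A. deg u)"
    unfolding arcs_def B_def by (rule sum.subset_diff[OF A finite_V])
  moreover have "(\<Sum>u\<in>A. deg u) \<le> X"
    unfolding X_def
  proof (rule sum_mono)
    fix u assume "u \<in> A"
    then show "deg u \<le> deg_in B u"
      using deg_le_inner[OF A, of u] A by (auto simp: inner opposite_def B_def)
  qed
  moreover have "(\<Sum>u\<in>B. deg u) \<le> (\<Sum>u\<in>B. deg_in A u)"
  proof (rule sum_mono)
    fix u assume "u \<in> B"
    then show "deg u \<le> deg_in A u"
      using deg_le_inner[OF A, of u] by (auto simp: inner opposite_def B_def)
  qed
  moreover have "(\<Sum>u\<in>B. deg_in A u) = X" unfolding X_def by (rule sum_deg_in_swap)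
  ultimately have "arcs \<le> 2 * X" by simp
  then have 2: "lam\<^sup>2 \<le> X" using 1 by simp
  have X: "real (card A) * real (card B) - X = (\<Sum>u\<in>A. \<Sum>v\<in>B. 1 - e u v)"
    by (simp add: X_def deg_in_def sum_subtractf del: sum_of_bool_eq)
  moreover have "\<dots> \<ge> 0" by (intro sum_nonneg) auto
  ultimately have le: "real f * (real n - real f) \<le> real (card A) * real (card B)"
    using 2 lam_ge by linarith
  have nf: "real (n - f) = real n - real f" by (rule of_nat_diff) (simp add: f_def)
  from le have "real (f * (n - f)) \<le> real (card A * card B)" by (simp only: of_nat_mult nf)
  then have "f * (n - f) \<le> card A * card B" by (simp only: of_nat_le_iff)
  then have bal: "(card A = f \<or> card B = f) \<and> card A * card B = f * (n - f)"
    using balanced_product[OF card] unfolding f_def by blast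
  then show "card A = f \<or> card (V - A) = f" by (simp add: B_def)
  have "real (card A) * real (card B) = real f * (real n - real f)"
    using bal nf by (metis of_nat_mult)
  then have zero: "(\<Sum>u\<in>A. \<Sum>v\<in>B. 1 - e u v) = 0"
    using 2 lam_ge X \<open>(\<Sum>u\<in>A. \<Sum>v\<in>B. 1 - e u v) \<ge> 0\<close> by linarith
  fix u v assume uv: "u \<in> A" "v \<in> V - A"
  have fin: "finite A" "finite B" using A finite_V finite_subset by (auto simp: B_def)
  have "(\<Sum>v\<in>B. 1 - e u v) = 0"
    using zero uv fin by (subst (asm) sum_nonneg_eq_0_iff) (auto intro!: sum_nonneg)
  then have "1 - e u v = 0"
    using uv fin by (subst (asm) sum_nonneg_eq_0_iff) (auto simp: B_def)
  then show "adj u v" by (cases "adj u v") auto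
qed

text \<open>The sums of the Perron vector over \<open>A\<close>, its complement \<open>B\<close>, the common neighbours \<open>C\<close> of the
  edge \<open>u1 u2\<close>, and \<open>{u1, u2}\<close> satisfy a closed system of inequalities, which bounds \<open>lam\<close>.\<close>

lemma no_single_inner_edge:
  assumes A: "A \<subseteq> V" and u1: "u1 \<in> V - A" and u2: "u2 \<in> V - A" and u12: "adj u1 u2"
    and inner: "\<And>u v. adj u v \<Longrightarrow> (u \<in> A \<longleftrightarrow> v \<in> A) \<Longrightarrow> u = u1 \<and> v = u2 \<or> u = u2 \<and> v = u1"
  shows False
proof -
  define B where "B = V - A"
  define C where "C = {v \<in> A. adj u1 v \<and> adj u2 v}"
  define a where "a = card A"
  define b where "b = card B"
  define c where "c = card C"
  have CA: "C \<subseteq> A" by (auto simp: C_def)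
  have fin: "finite A" "finite B" "finite C"
    using finite_subset[OF A finite_V] finite_V finite_subset[OF CA] by (simp_all add: B_def)
  have B: "u1 \<in> B" "u2 \<in> B" using u1 u2 by (auto simp: B_def)
  have ne: "u1 \<noteq> u2" using u12 adj_irrefl by auto
  have ab: "a + b = n" unfolding a_def b_def B_def by (rule card_Diff_A[OF A])
  have "card {u1, u2} \<le> b" unfolding b_def by (rule card_mono) (use B fin in auto)
  then have b2: "b \<ge> 2" using ne by simp

  \<comment> \<open>If \<open>C\<close> is nonempty, the inner edge gives two triangular arcs and
    each common neighbour four more. So \<open>4 * c + 2 <= 4 * f - 4\<close>, and integrality
    rounds \<open>f - 3/2\<close> down to \<open>f - 2\<close>.\<close>
  have c_le: "c + 2 \<le> f"
  proof (cases "C = {}")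
    case True
    then show ?thesis using f_bounds N_ge by (simp add: c_def)
  next
    case False
    have tri12: "tri u1 u2" "tri u2 u1" using False u12 adj_sym by (auto simp: tri_def C_def)
    have triC: "tri u1 w" "tri u2 w" "tri w u1" "tri w u2" if "w \<in> C" for w
      using that u12 adj_sym unfolding tri_def C_def by blast+
    have "real c + 1 \<le> tdeg u1"
    proof -
      have "(\<Sum>w\<in>insert u2 C. t u1 w) = (\<Sum>w\<in>insert u2 C. 1)"
        using tri12 triC by (intro sum.cong) auto
      also have "\<dots> = real c + 1" using fin CA B by (subst sum.insert) (auto simp: c_def B_def)
      finally show ?thesis using sum_tri_le_tdeg[of "insert u2 C" u1] CA A u2 by auto
    qed
    moreover have "real c + 1 \<le> tdeg u2"
    proof -
      have "(\<Sum>w\<in>insert u1 C. t u2 w) = (\<Sum>w\<in>insert u1 C. 1)"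
        using tri12 triC by (intro sum.cong) auto
      also have "\<dots> = real c + 1" using fin CA B by (subst sum.insert) (auto simp: c_def B_def)
      finally show ?thesis using sum_tri_le_tdeg[of "insert u1 C" u2] CA A u1 by auto
    qed
    moreover have "2 \<le> tdeg w" if "w \<in> C" for w
    proof -
      have "(\<Sum>v\<in>{u1, u2}. t w v) = 2" using ne triC[OF that] by simp
      then show ?thesis using sum_tri_le_tdeg[of "{u1, u2}" w] u1 u2 by auto
    qed
    then have "(\<Sum>w\<in>C. 2) \<le> (\<Sum>w\<in>C. tdeg w)" by (intro sum_mono)
    then have "2 * real c \<le> (\<Sum>w\<in>C. tdeg w)" by (simp add: c_def)
    moreover have "(\<Sum>w\<in>insert u1 (insert u2 C). tdeg w) = tdeg u1 + (tdeg u2 + (\<Sum>w\<in>C. tdeg w))"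
      using fin ne u1 u2 CA by (subst sum.insert; auto)+
    moreover have "(\<Sum>w\<in>insert u1 (insert u2 C). tdeg w) \<le> tarcs"
      by (rule sum_tdeg_le_tarcs) (use u1 u2 CA A in auto)
    ultimately have "4 * real c + 2 \<le> tarcs" by linarith
    then have "4 * real c + 2 \<le> 4 * real f - 4" using tarcs_le by linarith
    then show ?thesis by linarith
  qed

  define SA where "SA = (\<Sum>v\<in>A. x v)"
  define SB where "SB = (\<Sum>v\<in>B. x v)"
  define SC where "SC = (\<Sum>v\<in>C. x v)"
  define P where "P = x u1 + x u2"
  have nonneg: "SA \<ge> 0" "SB \<ge> 0" "SC \<ge> 0" "P \<ge> 0"
    unfolding SA_def SB_def SC_def P_def using x_nonneg by (simp_all add: sum_nonneg)
  have split: "adj_op x u = (\<Sum>v\<in>B. e u v * x v) + (\<Sum>v\<in>A. e u v * x v)" for u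
    unfolding adj_op_def B_def by (rule sum.subset_diff[OF A finite_V])
  have AA: "(\<Sum>v\<in>A. e u v * x v) = 0" if "u \<in> A" for u
  proof (rule sum.neutral, rule ballI)
    fix v assume "v \<in> A"
    then have "\<not> adj u v" using inner[of u v] that u1 u2 by blast
    then show "e u v * x v = 0" by simp
  qed
  have BB: "(\<Sum>v\<in>B. e u v * x v) = (if u = u1 then x u2 else 0) + (if u = u2 then x u1 else 0)"
    if "u \<in> B" for u
  proof -
    have "e u v = (if v = u2 then of_bool (u = u1) else 0) + (if v = u1 then of_bool (u = u2) else 0)"
      if v: "v \<in> B" for v
    proof -
      have "adj u v \<longleftrightarrow> u = u1 \<and> v = u2 \<or> u = u2 \<and> v = u1"
        using inner[of u v] u12 adj_sym[OF u12] v \<open>u \<in> B\<close> by (auto simp: B_def)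
      then show ?thesis using ne by auto
    qed
    then have "(\<Sum>v\<in>B. e u v * x v)
        = (\<Sum>v\<in>B. (if v = u2 then of_bool (u = u1) * x v else 0) + (if v = u1 then of_bool (u = u2) * x v else 0))"
      by (intro sum.cong) (auto simp: ne)
    also have "\<dots> = of_bool (u = u1) * x u2 + of_bool (u = u2) * x u1"
      unfolding sum.distrib using fin B by (simp add: sum.delta)
    finally show ?thesis by auto
  qed

  have lamA: "lam * (\<Sum>v\<in>W. x v) = (\<Sum>w\<in>B. deg_in W w * x w)" if "W \<subseteq> A" for W
  proof -
    have "lam * (\<Sum>v\<in>W. x v) = (\<Sum>v\<in>W. adj_op x v)"
      unfolding sum_distrib_left using x_eigen that A by (intro sum.cong) auto
    also have "\<dots> = (\<Sum>v\<in>W. \<Sum>w\<in>B. e v w * x w)"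
      using that by (intro sum.cong) (auto simp: split AA)
    also have "\<dots> = (\<Sum>w\<in>B. \<Sum>v\<in>W. e v w * x w)" by (rule sum.swap)
    also have "\<dots> = (\<Sum>w\<in>B. deg_in W w * x w)"
      unfolding deg_in_def sum_distrib_right by (simp only: e_commute)
    finally show ?thesis .
  qed
  have lamC: "lam * SC \<le> real c * SB"
  proof -
    have "lam * SC = (\<Sum>w\<in>B. deg_in C w * x w)" unfolding SC_def by (rule lamA[OF CA])
    also have "\<dots> \<le> (\<Sum>w\<in>B. real c * x w)"
      unfolding c_def by (intro sum_mono mult_right_mono deg_in_le_card x_nonneg)
    finally show ?thesis by (simp add: SB_def sum_distrib_left)
  qed
  have lamA0: "lam * SA \<le> real a * SB"
  proof -
    have "lam * SA = (\<Sum>w\<in>B. deg_in A w * x w)" unfolding SA_def by (rule lamA[OF subset_refl])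
    also have "\<dots> \<le> (\<Sum>w\<in>B. real a * x w)"
      unfolding a_def by (intro sum_mono mult_right_mono deg_in_le_card x_nonneg)
    finally show ?thesis by (simp add: SB_def sum_distrib_left)
  qed
  \<comment> \<open>A missing cross pair at \<open>u\<close> gains \<open>x u\<close> over
    \<open>lamA0\<close>; this supplies the strictness when \<open>C\<close> is not all of
    \<open>A\<close>.\<close>
  have lamA1: "lam * SA \<le> real a * SB - x u" if u: "u \<in> B" "v \<in> A" "\<not> adj u v" for u v
  proof -
    have d: "deg_in A w \<le> real a - of_bool (w = u)" for w
    proof (cases "w = u")
      case True
      have "deg_in A u = deg_in {v} u + deg_in (A - {v}) u" by (rule deg_in_Diff) (use u A in auto)
      also have "deg_in {v} u = 0" using u by (simp add: deg_in_def)
      also have "deg_in (A - {v}) u \<le> real (card (A - {v}))" by (rule deg_in_le_card)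
      also have "real (card (A - {v})) = real a - 1"
        using u fin card_Suc_Diff1[of A v] unfolding a_def by linarith
      finally show ?thesis using True by simp
    next
      case False
      then show ?thesis using deg_in_le_card[of A w] by (simp add: a_def)
    qed
    have "lam * SA = (\<Sum>w\<in>B. deg_in A w * x w)" unfolding SA_def by (rule lamA[OF subset_refl])
    also have "\<dots> \<le> (\<Sum>w\<in>B. (real a - of_bool (w = u)) * x w)"
      by (intro sum_mono mult_right_mono d x_nonneg)
    also have "\<dots> = (\<Sum>w\<in>B. real a * x w - (if w = u then x w else 0))"
      by (intro sum.cong) (auto simp: algebra_simps)
    also have "\<dots> = real a * SB - x u"
      using u fin by (simp add: sum_subtractf SB_def sum_distrib_left)
    finally show ?thesis .
  qed
  have SC_if: "SC = (\<Sum>v\<in>A. of_bool (v \<in> C) * x v)"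
    unfolding SC_def using CA fin by (intro sum.mono_neutral_cong_left) auto
  \<comment> \<open>A vertex of \<open>A\<close> is seen from both ends of the inner edge only if it
    lies in \<open>C\<close>.\<close>
  have lamP: "lam * P \<le> P + SA + SC"
  proof -
    have "lam * P = adj_op x u1 + adj_op x u2"
      using x_eigen u1 u2 by (simp add: P_def distrib_left)
    also have "\<dots> = P + (\<Sum>v\<in>A. e u1 v * x v + e u2 v * x v)"
      using BB[OF B(1)] BB[OF B(2)] ne by (simp add: split P_def sum.distrib del: sum_of_bool_mult_eq)
    also have "(\<Sum>v\<in>A. e u1 v * x v + e u2 v * x v) \<le> (\<Sum>v\<in>A. x v + of_bool (v \<in> C) * x v)"
      by (intro sum_mono) (auto simp: C_def x_nonneg)
    also have "\<dots> = SA + SC" by (simp only: sum.distrib SA_def SC_if)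
    finally show ?thesis by simp
  qed
  \<comment> \<open>A vertex of \<open>A\<close> outside \<open>C\<close> misses \<open>u1\<close>
    or \<open>u2\<close>, so it has at most \<open>b - 1\<close> neighbours in
    \<open>B\<close>.\<close>
  have lamB: "lam * SB \<le> (real b - 1) * SA + SC + P"
  proof -
    have d: "deg_in B v \<le> real b - 1 + of_bool (v \<in> C)" if v: "v \<in> A" for v
    proof (cases "v \<in> C")
      case True
      then show ?thesis using deg_in_le_card[of B v] by (simp add: b_def)
    next
      case False
      then obtain u where u: "u \<in> B" "\<not> adj v u"
        using v B adj_sym by (auto simp: C_def)
      have "deg_in B v = deg_in {u} v + deg_in (B - {u}) v"
        by (rule deg_in_Diff) (use u in \<open>auto simp: B_def\<close>)
      also have "deg_in {u} v = 0" using u by (simp add: deg_in_def)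
      also have "deg_in (B - {u}) v \<le> real (card (B - {u}))" by (rule deg_in_le_card)
      also have "real (card (B - {u})) = real b - 1"
        using u fin card_Suc_Diff1[of B u] unfolding b_def by linarith
      finally show ?thesis using False by simp
    qed
    have "lam * SB = (\<Sum>u\<in>B. adj_op x u)"
      unfolding SB_def sum_distrib_left using x_eigen by (intro sum.cong) (auto simp: B_def)
    also have "\<dots> = (\<Sum>u\<in>B. (if u = u1 then x u2 else 0) + (if u = u2 then x u1 else 0) + (\<Sum>v\<in>A. e u v * x v))"
      by (intro sum.cong refl) (simp only: split BB)
    also have "\<dots> = P + (\<Sum>u\<in>B. \<Sum>v\<in>A. e u v * x v)"
      unfolding sum.distrib using fin B by (simp add: P_def)
    also have "(\<Sum>u\<in>B. \<Sum>v\<in>A. e u v * x v) = (\<Sum>v\<in>A. \<Sum>u\<in>B. e u v * x v)" by (rule sum.swap)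
    also have "\<dots> = (\<Sum>v\<in>A. deg_in B v * x v)"
      unfolding deg_in_def sum_distrib_right by (simp only: e_commute)
    also have "\<dots> \<le> (\<Sum>v\<in>A. (real b - 1 + of_bool (v \<in> C)) * x v)"
      by (intro sum_mono mult_right_mono d x_nonneg)
    also have "\<dots> = (\<Sum>v\<in>A. (real b - 1) * x v + of_bool (v \<in> C) * x v)"
      by (simp only: distrib_right)
    also have "\<dots> = (real b - 1) * SA + SC"
      by (simp only: sum.distrib SA_def SC_if sum_distrib_left)
    finally show ?thesis by simp
  qed

  have lam2: "lam \<ge> 2" using lam_ge_N N_ge by linarith
  have SB: "SB > 0"
  proof (rule ccontr)
    assume "\<not> SB > 0"
    then have "SB = 0" using nonneg by simp
    then have "SA = 0" using lamA0 nonneg lam2 by (simp add: mult_le_0_iff)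
    have "x v = 0" if "v \<in> V" for v
      using that \<open>SA = 0\<close> \<open>SB = 0\<close> fin x_nonneg
      by (cases "v \<in> A") (auto simp: SA_def SB_def B_def sum_nonneg_eq_0_iff)
    then show False using x_unit by simp
  qed
  define s where "s = lam\<^sup>2 - real a * (real n - real a) + real a - real c"
  have f2: "f \<ge> 2" using f_bounds N_ge by linarith
  have s: "s > 0" "(lam - 1) * s \<ge> real a + real c" "a \<noteq> c \<or> (lam - 1) * s > real a + real c"
    unfolding s_def using unbalanced_bound[OF f2 f_def c_le _ lam_ge_f lam_ge, of a] ab by auto
  have rb: "real b = real n - real a" using ab by linarith
  \<comment> \<open>Multiplying \<open>lamB\<close> by \<open>lam\<close> allows \<open>SA\<close>
    and \<open>SC\<close> to be eliminated in favour of \<open>SB\<close>. The factor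
    \<open>lam - 1\<close> then eliminates \<open>P\<close>, because \<open>lamP\<close> bounds
    \<open>(lam - 1) * P\<close>. The slack \<open>y\<close> is 0 or the gain from
    \<open>lamA1\<close>.\<close>
  have key: "SB * ((lam - 1) * s - (real a + real c)) \<le> - ((lam - 1) * ((real b - 1) * y))"
    if y: "lam * SA \<le> real a * SB - y" "y \<ge> 0" for y
  proof -
    have "lam * (lam * SB) \<le> lam * ((real b - 1) * SA + SC + P)"
      using lamB lam2 by (intro mult_left_mono) auto
    also have "\<dots> = (real b - 1) * (lam * SA) + lam * SC + lam * P" by (simp add: algebra_simps)
    also have "\<dots> \<le> (real b - 1) * (real a * SB - y) + real c * SB + lam * P"
      using y(1) lamC b2 lam2 by (intro add_mono mult_left_mono) auto
    finally have 1: "SB * s \<le> lam * P - (real b - 1) * y"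
      unfolding s_def rb by (simp add: power2_eq_square algebra_simps)
    have "lam * ((lam - 1) * P) \<le> lam * (SA + SC)"
      using lamP lam2 by (intro mult_left_mono) (auto simp: algebra_simps)
    also have "\<dots> \<le> (real a + real c) * SB" using y lamC by (simp add: algebra_simps)
    finally have 2: "(lam - 1) * (lam * P) \<le> (real a + real c) * SB" by (simp add: mult_ac)
    have "(lam - 1) * (SB * s) \<le> (lam - 1) * (lam * P - (real b - 1) * y)"
      using 1 lam2 by (intro mult_left_mono) auto
    then show ?thesis using 2 by (simp add: algebra_simps)
  qed
  show False
  proof (cases "a = c")
    case True
    then have "SB * ((lam - 1) * s - (real a + real c)) > 0" using s SB by simp
    then show False using key[of 0] lamA0 by simp
  next
    case False
    then have "C \<noteq> A" by (auto simp: a_def c_def)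
    then obtain u u' v where u: "u \<in> B" "v \<in> A" "\<not> adj u v" and uu': "u' \<in> B" "adj u u'" "P = x u + x u'"
    proof -
      obtain v where v: "v \<in> A" "\<not> adj u1 v \<or> \<not> adj u2 v"
        using \<open>C \<noteq> A\<close> CA by (auto simp: C_def)
      then show ?thesis
        using that[of u1 v u2] that[of u2 v u1] B u12 adj_sym by (auto simp: P_def)
    qed
    have le: "lam * SA \<le> real a * SB - x u" by (rule lamA1[OF u])
    \<comment> \<open>The gain \<open>x u\<close> may be 0, as \<open>x\<close> need not be
      positive. The eigenvalue equation at \<open>u\<close> then makes the other end
      \<open>u'\<close> vanish too, and \<open>lamB\<close> without \<open>P\<close> already
      contradicts \<open>s > 0\<close>.\<close>
    show False
    proof (cases "x u = 0")
      case True
      have "e u u' * x u' \<le> adj_op x u"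
        unfolding adj_op_def using uu' finite_V x_nonneg by (intro member_le_sum) (auto simp: B_def)
      then have "x u' \<le> 0" using uu' x_eigen[of u] u True by (auto simp: B_def)
      then have "x u' = 0" using x_nonneg[of u'] by simp
      then have "P = 0" using uu' True by simp
      have "lam * (lam * SB) \<le> lam * ((real b - 1) * SA + SC + P)"
        using lamB lam2 by (intro mult_left_mono) auto
      also have "\<dots> = (real b - 1) * (lam * SA) + lam * SC" using \<open>P = 0\<close> by (simp add: algebra_simps)
      also have "\<dots> \<le> (real b - 1) * (real a * SB) + real c * SB"
        using lamA0 lamC b2 by (intro add_mono mult_left_mono) auto
      finally have "SB * s \<le> 0"
        unfolding s_def rb by (simp add: power2_eq_square algebra_simps)
      then show False using SB s(1) by (simp add: mult_le_0_iff)
    next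
      case False
      then have "x u > 0" using x_nonneg[of u] by simp
      then have "(lam - 1) * ((real b - 1) * x u) > 0" using lam2 b2 by simp
      moreover have "SB * ((lam - 1) * s - (real a + real c)) \<ge> 0" using s SB by simp
      ultimately show False using key[OF le] x_nonneg[of u] by linarith
    qed
  qed
qed

lemma complete_balanced_bipartite:
  obtains A where "A \<subseteq> V" "card A = f" "\<And>u v. adj u v \<longleftrightarrow> u \<in> V \<and> v \<in> V \<and> (u \<in> A) \<noteq> (v \<in> A)"
proof -
  obtain A where A: "A \<subseteq> V" "card (inner A) \<le> 2" by (rule ex_near_bipartition)
  have inner: "inner A = {}"
  proof (rule ccontr)
    assume "inner A \<noteq> {}"
    then obtain u1 u2 where u: "u1 \<in> V" "adj u1 u2" "u1 \<in> A \<longleftrightarrow> u2 \<in> A" by (auto simp: inner_def)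
    have u2: "u2 \<in> V" using u adj_sym adj_V by blast
    have "u1 \<noteq> u2" using u adj_irrefl by auto
    have "{u1, u2} \<subseteq> inner A" unfolding inner_def using u u2 adj_sym by blast
    moreover have "card {u1, u2} = 2" using \<open>u1 \<noteq> u2\<close> by simp
    moreover have "finite (inner A)" using finite_V by (simp add: inner_def)
    ultimately have in2: "inner A = {u1, u2}" using A(2) by (metis card_seteq)
    have edge: "p = u1 \<and> q = u2 \<or> p = u2 \<and> q = u1" if "adj p q" "p \<in> A \<longleftrightarrow> q \<in> A" for p q
    proof -
      have "p \<in> inner A" "q \<in> inner A"
        unfolding inner_def using that adj_V adj_sym by blast+
      moreover have "p \<noteq> q" using that adj_irrefl by blast
      ultimately show ?thesis unfolding in2 by blast
    qed
    show False
    \<comment> \<open>\<open>no_single_inner_edge\<close> expects the edge outside its set, so the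
      two parts swap roles when it lies in \<open>A\<close>.\<close>
    proof (cases "u1 \<in> A")
      case True
      show False
      proof (rule no_single_inner_edge[of "V - A" u1 u2])
        fix p q assume "adj p q" "p \<in> V - A \<longleftrightarrow> q \<in> V - A"
        then show "p = u1 \<and> q = u2 \<or> p = u2 \<and> q = u1"
          using edge[of p q] adj_V[of p q] adj_V[of q p] adj_sym[of p q] by blast
      qed (use True u u2 in auto)
    next
      case False
      show False by (rule no_single_inner_edge[OF A(1) _ _ u(2) edge]) (use False u u2 in auto)
    qed
  qed
  note bip = complete_bipartite_if_no_inner[OF A(1) inner]
  have adj: "adj u v \<longleftrightarrow> u \<in> V \<and> v \<in> V \<and> (u \<in> A) \<noteq> (v \<in> A)" for u v
  proof
    assume uv: "adj u v"
    then have "u \<in> V" "v \<in> V" using adj_sym adj_V by blast+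
    then show "u \<in> V \<and> v \<in> V \<and> (u \<in> A) \<noteq> (v \<in> A)"
      using inner uv unfolding inner_def by blast
  next
    assume "u \<in> V \<and> v \<in> V \<and> (u \<in> A) \<noteq> (v \<in> A)"
    then show "adj u v" using bip(2)[of u v] bip(2)[of v u] adj_sym by blast
  qed
  show ?thesis
    using bip(1)
  proof
    assume "card A = f"
    then show ?thesis using that[of A] A adj by blast
  next
    assume "card (V - A) = f"
    moreover have "adj u v \<longleftrightarrow> u \<in> V \<and> v \<in> V \<and> (u \<in> V - A) \<noteq> (v \<in> V - A)" for u v
      using adj by blast
    ultimately show ?thesis using that[of "V - A"] by blast
  qed
qed

end

section \<open>Spectral radius and the Turan graph\<close>

lemma eigenvalue_le_graph_spectral_radius:
  assumes "finite (pverts G)" and "u \<in> pverts G" "y u \<noteq> 0"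
    and "\<And>u. u \<in> pverts G \<Longrightarrow> (\<Sum>v\<in>pverts G. if (u, v) \<in> parcs G then y v else 0) = k * y u"
  shows "k \<le> graph_spectral_radius G"
proof -
  obtain vs where vs: "distinct vs" "set vs = pverts G"
    using finite_distinct_list[OF assms(1)] by blast
  have "eigenvalue (adjacency_matrix vs G) k"
    unfolding eigenvalue_adjacency_matrix_iff[OF vs(1)] vs(2) using assms(2-4) by blast
  then have "k \<in> spectrum (adjacency_matrix vs G)" by (simp add: spectrum_def)
  moreover have "finite (spectrum (adjacency_matrix vs G))"
    by (rule card_finite_spectrum[of _ "length vs"]) (simp add: adjacency_matrix_def)
  ultimately show ?thesis
    unfolding graph_spectral_radius_eq[OF vs] by (rule Max_ge[rotated])
qed

lemma graph_spectral_radius_le: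
  assumes "perron (pverts G) (\<lambda>u v. (u, v) \<in> parcs G) lam x"
  shows "graph_spectral_radius G \<le> lam"
proof -
  interpret perron "pverts G" "\<lambda>u v. (u, v) \<in> parcs G" lam x by fact
  obtain vs where vs: "distinct vs" "set vs = pverts G"
    using finite_distinct_list[OF finite_V] by blast
  have op: "adj_op y u = (\<Sum>v\<in>pverts G. if (u, v) \<in> parcs G then y v else 0)" for y u
    unfolding adj_op_def by (intro sum.cong) auto
  have eig: "eigenvalue (adjacency_matrix vs G) k \<longleftrightarrow>
      (\<exists>y. (\<exists>u\<in>pverts G. y u \<noteq> 0) \<and> (\<forall>u\<in>pverts G. adj_op y u = k * y u))" for k
    unfolding eigenvalue_adjacency_matrix_iff[OF vs(1)] vs(2) op ..
  have fin: "finite (spectrum (adjacency_matrix vs G))"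
    by (rule card_finite_spectrum[of _ "length vs"]) (simp add: adjacency_matrix_def)
  \<comment> \<open>This puts \<open>lam\<close> into the spectrum, which must be nonempty before
    its \<open>Max\<close> can be bounded.\<close>
  have "\<exists>u\<in>pverts G. x u \<noteq> 0"
  proof (rule ccontr)
    assume "\<not> ?thesis"
    then have "(\<Sum>u\<in>pverts G. (x u)\<^sup>2) = 0" by simp
    then show False using x_unit by simp
  qed
  then have "lam \<in> spectrum (adjacency_matrix vs G)"
    unfolding spectrum_def mem_Collect_eq eig using x_eigen by blast
  moreover have "k \<le> lam" if k: "k \<in> spectrum (adjacency_matrix vs G)" for k
  proof -
    obtain y where y: "\<exists>u\<in>pverts G. y u \<noteq> 0" "\<And>u. u \<in> pverts G \<Longrightarrow> adj_op y u = k * y u"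
      using k unfolding spectrum_def mem_Collect_eq eig by blast
    have "(\<Sum>u\<in>pverts G. (y u)\<^sup>2) > 0"
      using y(1) finite_V by (metis (mono_tags, lifting) sum_pos2 zero_le_power2 zero_less_power2)
    moreover have "adj_form y = (\<Sum>u\<in>pverts G. k * (y u)\<^sup>2)"
      unfolding adj_form_def by (intro sum.cong) (auto simp: y(2) power2_eq_square)
    then have "k * (\<Sum>u\<in>pverts G. (y u)\<^sup>2) \<le> lam * (\<Sum>u\<in>pverts G. (y u)\<^sup>2)"
      using form_le[of y] by (simp add: sum_distrib_left)
    ultimately show ?thesis by simp
  qed
  ultimately show ?thesis
    unfolding graph_spectral_radius_eq[OF vs] using fin by (subst Max_le_iff) auto
qed

lemma ceiling_half: "nat \<lceil>real n / 2\<rceil> = n - n div 2"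
  by linarith

lemma turan_graph_2_eq:
  "turan_graph_2 n = \<lparr>pverts = {..<n},
    parcs = {..<n - n div 2} \<times> {n - n div 2..<n} \<union> {n - n div 2..<n} \<times> {..<n - n div 2}\<rparr>"
proof -
  have "{..<n - n div 2} \<union> {n - n div 2..<n} = {..<n}" by auto
  then show ?thesis unfolding turan_graph_2_def ceiling_half by (simp add: Let_def)
qed

text \<open>One explicit eigenvector suffices. It is constant on each part, and the eigenvalue
  equation reduces to \<open>f * sqrt g = sqrt (f * g) * sqrt f\<close> and its mirror
  image.\<close>

lemma turan_graph_2_spectral_radius_ge:
  assumes "n \<ge> 2"
  shows "sqrt (real (n div 2) * (real n - real (n div 2))) \<le> graph_spectral_radius (turan_graph_2 n)"
proof -
  define f where "f = n div 2"
  define g where "g = n - f"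
  define y where "y u = (if u < g then sqrt (real f) else sqrt (real g))" for u
  have fg: "g \<le> n" "n - g = f" "f > 0" "g > 0" using assms by (auto simp: f_def g_def)
  have T: "pverts (turan_graph_2 n) = {..<n}" "parcs (turan_graph_2 n) = {..<g} \<times> {g..<n} \<union> {g..<n} \<times> {..<g}"
    unfolding turan_graph_2_eq by (simp_all add: f_def g_def)
  have "sqrt (real f * real g) \<le> graph_spectral_radius (turan_graph_2 n)"
  proof (rule eigenvalue_le_graph_spectral_radius[of _ 0 y])
    fix u assume u: "u \<in> pverts (turan_graph_2 n)"
    show "(\<Sum>v\<in>pverts (turan_graph_2 n). if (u, v) \<in> parcs (turan_graph_2 n) then y v else 0)
        = sqrt (real f * real g) * y u"
    proof (cases "u < g")
      case True
      have "(\<Sum>v\<in>{..<n}. if (u, v) \<in> parcs (turan_graph_2 n) then y v else 0) = (\<Sum>v\<in>{g..<n}. sqrt (real g))"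
        using True by (intro sum.mono_neutral_cong_right) (auto simp: T y_def)
      then show ?thesis using True fg by (simp add: T(1) y_def real_sqrt_mult)
    next
      case False
      have "(\<Sum>v\<in>{..<n}. if (u, v) \<in> parcs (turan_graph_2 n) then y v else 0) = (\<Sum>v\<in>{..<g}. sqrt (real f))"
        using False u fg by (intro sum.mono_neutral_cong_right) (auto simp: T y_def)
      then show ?thesis using False by (simp add: T(1) y_def real_sqrt_mult)
    qed
  qed (use fg T in \<open>auto simp: y_def\<close>)
  moreover have "real g = real n - real f" unfolding g_def by (rule of_nat_diff) (simp add: f_def)
  ultimately show ?thesis by (simp add: f_def)
qed

lemma turan_graph_2_iso:
  assumes "pair_graph G" "card (pverts G) = n" "A \<subseteq> pverts G" "card A = n div 2"
    and adj: "\<And>u v. (u, v) \<in> parcs G \<longleftrightarrow> u \<in> pverts G \<and> v \<in> pverts G \<and> (u \<in> A) \<noteq> (v \<in> A)"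
  shows "graph_iso G (turan_graph_2 n)"
proof -
  interpret pair_graph G by fact
  define g where "g = n - n div 2"
  have fin: "finite (pverts G)" "finite A" using pair_finite_verts finite_subset[OF assms(3)] by auto
  have "card (pverts G - A) = g"
    using assms fin by (simp add: card_Diff_subset g_def)
  then obtain h1 where h1: "bij_betw h1 (pverts G - A) {..<g}"
    using ex_bij_betw_finite_nat[of "pverts G - A"] fin by (auto simp: atLeast0LessThan)
  \<comment> \<open>\<open>A\<close> has the floor size, so it is matched with the second block of
    \<open>turan_graph_2\<close>.\<close>
  have "card {g..<n} = card A" using assms by (simp add: g_def)
  then obtain h2 where h2: "bij_betw h2 A {g..<n}"
    using fin finite_same_card_bij by (metis finite_atLeastLessThan)
  define h where "h u = (if u \<in> A then h2 u else h1 u)" for u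
  have hA: "bij_betw h A {g..<n}" using h2 by (subst bij_betw_cong[of A h h2]) (auto simp: h_def)
  have hB: "bij_betw h (pverts G - A) {..<g}" using h1 by (subst bij_betw_cong[of _ h h1]) (auto simp: h_def)
  have "bij_betw h (A \<union> (pverts G - A)) ({g..<n} \<union> {..<g})"
    by (rule bij_betw_combine[OF hA hB]) auto
  moreover have "{g..<n} \<union> {..<g} = {..<n}" by (auto simp: g_def)
  moreover have "A \<union> (pverts G - A) = pverts G" using assms(3) by auto
  ultimately have h: "bij_betw h (pverts G) {..<n}" by simp
  have imA: "h ` A = {g..<n}" and imB: "h ` (pverts G - A) = {..<g}" and im: "h ` pverts G = {..<n}"
    and inj: "inj_on h (pverts G)"
    using hA hB h by (auto simp: bij_betw_def)
  define hom where "hom = \<lparr>iso_verts = h, iso_arcs = map_prod h h, iso_head = snd, iso_tail = fst\<rparr>"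
  have parcs: "parcs G = (pverts G - A) \<times> A \<union> A \<times> (pverts G - A)"
    using adj assms(3) by auto
  have "map_prod h h ` parcs G = {..<g} \<times> {g..<n} \<union> {g..<n} \<times> {..<g}"
    unfolding parcs image_Un map_prod_surj_on[OF imA imB] map_prod_surj_on[OF imB imA] ..
  then have "with_proj (turan_graph_2 n) = app_iso hom (with_proj G)"
    by (simp add: app_iso_def hom_def turan_graph_2_eq im g_def with_proj_def)
  moreover have "inj_on (map_prod h h) (parcs G)"
    by (rule inj_on_subset[OF map_prod_inj_on[OF inj inj]]) (auto simp: adj)
  then have "pre_digraph.digraph_isomorphism (with_proj G) hom"
    unfolding digraph_isomorphism_def hom_def using inj wf_digraph by auto
  ultimately show ?thesis unfolding digraph_iso_def by blast
qed

lemma (in simple_graph) tarcs_le_card_edges: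
  assumes "\<T> = {{u, v} | u v. tri u v}"
  shows "tarcs \<le> 2 * real (card \<T>)"
proof -
  define F where "F E = {(u, v). tri u v \<and> {u, v} = E}" for E
  have tri_V: "u \<in> V" "v \<in> V" if "tri u v" for u v
    using that adj_sym adj_V unfolding tri_def by blast+
  have "\<T> \<subseteq> Pow V" using tri_V by (auto simp: assms)
  then have fin: "finite \<T>" using finite_V finite_subset by blast
  have "tarcs = (\<Sum>(u, v)\<in>V \<times> V. t u v)" by (simp add: tarcs_def tdeg_def sum.cartesian_product del: sum_of_bool_eq)
  also have "\<dots> = (\<Sum>p\<in>V \<times> V. of_bool (tri (fst p) (snd p)))"
    by (simp only: case_prod_unfold)
  also have "\<dots> = real (card ((V \<times> V) \<inter> {p. tri (fst p) (snd p)}))"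
    using finite_V by (subst sum_of_bool_eq) auto
  also have "(V \<times> V) \<inter> {p. tri (fst p) (snd p)} = (\<Union>E\<in>\<T>. F E)"
    unfolding F_def assms using tri_V by fastforce
  also have "card \<dots> \<le> (\<Sum>E\<in>\<T>. card (F E))" by (rule card_UN_le[OF fin])
  also have "\<dots> \<le> (\<Sum>E\<in>\<T>. 2)"
  proof (rule sum_mono)
    fix E assume "E \<in> \<T>"
    then obtain u v where "E = {u, v}" by (auto simp: assms)
    then have "F E \<subseteq> {(u, v), (v, u)}" by (auto simp: F_def doubleton_eq_iff)
    then have "card (F E) \<le> card {(u, v), (v, u)}" by (rule card_mono[rotated]) simp
    also have "\<dots> \<le> 2" by (rule order_trans[OF card_insert_le_m1]) auto
    finally show "card (F E) \<le> 2" .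
  qed
  finally show ?thesis by simp
qed

theorem theorem2p1:
  fixes G :: "'a pair_pre_digraph" and n :: nat
  assumes "pair_graph G"
    and "card (pverts G) = n"
    and "n \<ge> 5432"
    and "graph_spectral_radius G \<ge> graph_spectral_radius (turan_graph_2 n)"
    and "\<not> graph_iso G (turan_graph_2 n)"
  shows "card (triangular_edges G) \<ge> 2 * (n div 2) - 1"
proof (rule ccontr)
  assume "\<not> ?thesis"
  then have few: "card (triangular_edges G) + 2 \<le> 2 * (n div 2)" by linarith
  interpret pair_graph G by fact
  define f where "f = n div 2"
  define adj where "adj u v \<longleftrightarrow> (u, v) \<in> parcs G" for u v
  interpret g: simple_graph "pverts G" adj
  proof
    fix u v
    show "adj u v \<Longrightarrow> adj v u"
      using pair_sym_arcs by (auto simp: adj_def symmetric_def dest: symD)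
    show "adj u v \<Longrightarrow> u \<in> pverts G"
      using arc_fst_in_verts by (force simp: adj_def)
    show "\<not> adj u u"
      using pair_no_loops[of "(u, u)"] by (auto simp: adj_def)
  qed (rule pair_finite_verts)
  have "pverts G \<noteq> {}" using assms(2,3) by auto
  then obtain lam x where perron: "perron (pverts G) adj lam x" by (rule g.ex_perron)
  have "sqrt (real f * (real n - real f)) \<le> lam"
    using turan_graph_2_spectral_radius_ge[of n] assms(3,4)
      graph_spectral_radius_le[OF perron[unfolded adj_def[abs_def]]]
    by (simp add: f_def)
  moreover have "real f * (real n - real f) \<ge> 0"
    by (rule mult_nonneg_nonneg) (auto simp: f_def)
  ultimately have lam: "real f * (real n - real f) \<le> lam\<^sup>2"
    by (metis power_mono real_sqrt_ge_zero real_sqrt_pow2)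
  have "g.tarcs \<le> 2 * real (card (triangular_edges G))"
    by (rule g.tarcs_le_card_edges) (simp add: triangular_edges_def g.tri_def adj_def)
  then have tarcs: "g.tarcs \<le> 4 * real f - 4" using few unfolding f_def by linarith
  interpret few_triangular_edges "pverts G" adj lam x n f
    by (intro few_triangular_edges.intro perron few_triangular_edges_axioms.intro)
      (use assms lam tarcs in \<open>auto simp: f_def\<close>)
  obtain A where "A \<subseteq> pverts G" "card A = f"
    "\<And>u v. adj u v \<longleftrightarrow> u \<in> pverts G \<and> v \<in> pverts G \<and> (u \<in> A) \<noteq> (v \<in> A)"
    by (rule complete_balanced_bipartite) blast
  then have "graph_iso G (turan_graph_2 n)"
    using turan_graph_2_iso[OF assms(1,2)] by (simp add: f_def adj_def)
  then show False using assms(5) by contradiction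
qed

end
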